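(* Let $N\ge2$, $\alpha,\beta\in\{x,y,z\}$ with $\alpha\neq\beta$, and consider the Hamiltonian $$H(t)=\sum_{i=1}^{N-1}J_i^\alpha(t)\,\sigma_i^\alpha\sigma_{i+1}^\alpha+J_i^\beta(t)\,\sigma_i^\beta\sigma_{i+1}^\beta$$ with nonzero real coefficients. Let $\Delta t>0$, let $n_t>N/2$ be an integer, $t_\tau=t_0+\tau\Delta t$, and let $$U(n_t\Delta t)=U_{n_t}\cdots U_2U_1,\qquad U_\tau=\prod_{i\ \mathrm{even}}R_i^{\alpha\beta}(2J_i^\alpha(t_\tau)\Delta t,2J_i^\beta(t_\tau)\Delta t)\ \prod_{i\ \mathrm{odd}}R_i^{\alpha\beta}(2J_i^\alpha(t_\tau)\Delta t,2J_i^\beta(t_\tau)\Delta t).$$ Then: (1) $U(n_t\Delta t)$ is equal to the product of the operators of two triangle circuits on $N$ spins, where in the first one the gates at odd positions $i$ are of the form $R_i^{\alpha\alpha}(\theta)$ and those at even positions $i$ of the form $R_i^{\beta\beta}(\theta)$, and in the second one the gates at odd positions $i$ are of the form $R_i^{\beta\beta}(\theta)$ and those at even positions $i$ of the form $R_i^{\alpha\alpha}(\theta)$. (2) $U(n_t\Delta t)$ is equal to the operator of a single triangle circuit on $N$ spins in which every gate at position $i$ is of the form $R_i^{\alpha\beta}(\theta,\theta')$ with real $\theta,\theta'$, and also to the operator of a square circuit on $N$ spins with gates of this form. In particular $U(n_t\Delta t)$ is implemented by a circuit of depth $O(N)$, independent of $n_t$.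
   Context: $\sigma^x,\sigma^y,\sigma^z$ are the Pauli matrices, and $\sigma_i^\alpha=I^{\otimes(i-1)}\otimes\sigma^\alpha\otimes I^{\otimes(N-i)}$ on $(\mathbb C^2)^{\otimes N}$. For $1\le i\le N-1$, $R_i^{\alpha\alpha}(\theta)=\exp(-\mathrm{i}\,\sigma_i^\alpha\sigma_{i+1}^\alpha\,\theta/2)$ and $R_i^{\alpha\beta}(\theta,\theta')=R_i^{\alpha\alpha}(\theta)R_i^{\beta\beta}(\theta')$ (the two factors commute); these are gates at position $i$ (acting on spins $i,i+1$). Products over odd/even $i$ run over $i\in\{1,\dots,N-1\}$. A circuit is a time-ordered sequence of gates $g_1,\dots,g_m$ (first to last) with operator $g_m\cdots g_1$. An odd (even) layer consists of one gate at each odd (even) position in $\{1,\dots,N-1\}$. A square circuit on $N$ spins consists of $N$ layers, in time order alternately odd and even, the first being odd. A triangle circuit on $N$ spins consists, in time order, of $N-1$ descending cascades, the $k$-th containing $k$ gates at positions $N-k,N-k+1,\dots,N-1$ in this time order. *)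

theory Defs
  imports "Jordan_Normal_Form.Matrix" "HOL-Library.Landau_Symbols" Complex_Main
begin

definition kron :: "complex mat \<Rightarrow> complex mat \<Rightarrow> complex mat" where
  "kron A B = mat (dim_row A * dim_row B) (dim_col A * dim_col B)
     (\<lambda>(r, c). A $$ (r div dim_row B, c div dim_col B) * B $$ (r mod dim_row B, c mod dim_col B))"

text \<open>The exponential series, summed entry by entry; since matrices carry their dimension as
  a value, the library constant \<open>exp\<close> is not available for them.\<close>

definition mat_exp :: "complex mat \<Rightarrow> complex mat" where
  "mat_exp A = mat (dim_row A) (dim_row A) (\<lambda>(r, c). \<Sum>k. (A ^\<^sub>m k) $$ (r, c) / fact k)"

datatype pauli = PX | PY | PZ

fun pauli_mat :: "pauli \<Rightarrow> complex mat" where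
  "pauli_mat PX = mat_of_rows_list 2 [[0, 1], [1, 0]]"
| "pauli_mat PY = mat_of_rows_list 2 [[0, - \<i>], [\<i>, 0]]"
| "pauli_mat PZ = mat_of_rows_list 2 [[1, 0], [0, - 1]]"

text \<open>Spins are numbered from \<open>1\<close> to \<open>N\<close>.\<close>

definition spin_op :: "nat \<Rightarrow> pauli \<Rightarrow> nat \<Rightarrow> complex mat" where
  "spin_op N a i = kron (kron (1\<^sub>m (2 ^ (i - 1))) (pauli_mat a)) (1\<^sub>m (2 ^ (N - i)))"

definition rot :: "nat \<Rightarrow> pauli \<Rightarrow> nat \<Rightarrow> real \<Rightarrow> complex mat" where
  "rot N a i \<theta> =
     mat_exp ((- \<i> * complex_of_real (\<theta> / 2)) \<cdot>\<^sub>m (spin_op N a i * spin_op N a (i + 1)))"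

definition rot2 :: "nat \<Rightarrow> pauli \<Rightarrow> pauli \<Rightarrow> nat \<Rightarrow> real \<Rightarrow> real \<Rightarrow> complex mat" where
  "rot2 N a b i \<theta> \<theta>' = rot N a i \<theta> * rot N b i \<theta>'"

text \<open>For a list \<open>[g\<^sub>1, \<dots>, g\<^sub>m]\<close> in time order this is the product with \<open>g\<^sub>1\<close> rightmost.\<close>

definition time_ordered_prod :: "nat \<Rightarrow> complex mat list \<Rightarrow> complex mat" where
  "time_ordered_prod N gs = fold (*) gs (1\<^sub>m (2 ^ N))"

text \<open>A gate is a pair of its position \<open>i\<close> (it acts on the spins \<open>i\<close> and \<open>i + 1\<close>) and its
  operator on all \<open>N\<close> spins.  That the operator really acts on these two spins only is ensured
  wherever circuits are used by requiring it to be a \<open>rot\<close> or \<open>rot2\<close> at position \<open>i\<close>.\<close>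

type_synonym gate = "nat \<times> complex mat"

type_synonym circuit = "gate list"

definition circuit_op :: "nat \<Rightarrow> circuit \<Rightarrow> complex mat" where
  "circuit_op N c = time_ordered_prod N (map snd c)"

definition is_circuit :: "nat \<Rightarrow> circuit \<Rightarrow> bool" where
  "is_circuit N c \<longleftrightarrow> (\<forall>(i, g) \<in> set c. 1 \<le> i \<and> i \<le> N - 1)"

definition is_odd_layer :: "nat \<Rightarrow> circuit \<Rightarrow> bool" where
  "is_odd_layer N L \<longleftrightarrow> distinct (map fst L) \<and> fst ` set L = {i \<in> {1..N - 1}. odd i}"

definition is_even_layer :: "nat \<Rightarrow> circuit \<Rightarrow> bool" where
  "is_even_layer N L \<longleftrightarrow> distinct (map fst L) \<and> fst ` set L = {i \<in> {1..N - 1}. even i}"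

text \<open>Layers are indexed from \<open>0\<close> here, so the first, third, \<dots> layers have even index.\<close>

definition is_square_circuit :: "nat \<Rightarrow> circuit \<Rightarrow> bool" where
  "is_square_circuit N c \<longleftrightarrow>
     (\<exists>Ls. c = concat Ls \<and> length Ls = N \<and>
        (\<forall>k < N. if even k then is_odd_layer N (Ls ! k) else is_even_layer N (Ls ! k)))"

definition is_triangle_circuit :: "nat \<Rightarrow> circuit \<Rightarrow> bool" where
  "is_triangle_circuit N c \<longleftrightarrow> map fst c = concat (map (\<lambda>k. [N - k..<N]) [1..<N])"

text \<open>The depth is the least number of time steps in which the gates can be executed such that
  gates sharing a spin (those whose positions differ by at most one) are executed in different
  steps, in the order of the circuit.\<close>

definition depth :: "circuit \<Rightarrow> nat" where
  "depth c = (LEAST D. \<exists>step :: nat \<Rightarrow> nat.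
     (\<forall>p < length c. step p < D) \<and>
     (\<forall>p q. p < q \<and> q < length c \<and> {fst (c ! p), fst (c ! p) + 1} \<inter> {fst (c ! q), fst (c ! q) + 1} \<noteq> {}
        \<longrightarrow> step p < step q))"

definition hamiltonian ::
  "nat \<Rightarrow> pauli \<Rightarrow> pauli \<Rightarrow> (pauli \<Rightarrow> nat \<Rightarrow> real \<Rightarrow> real) \<Rightarrow> real \<Rightarrow> complex mat" where
  "hamiltonian N a b J t = foldr (+)
     (map (\<lambda>i. complex_of_real (J a i t) \<cdot>\<^sub>m (spin_op N a i * spin_op N a (i + 1)) +
               complex_of_real (J b i t) \<cdot>\<^sub>m (spin_op N b i * spin_op N b (i + 1))) [1..<N])
     (0\<^sub>m (2 ^ N) (2 ^ N))"

text \<open>The evolution over one time step, with the coefficients taken at the time \<open>t\<close>.  The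
  factors in each of the two products commute, so their order is irrelevant.\<close>

definition trotter_step ::
  "nat \<Rightarrow> pauli \<Rightarrow> pauli \<Rightarrow> (pauli \<Rightarrow> nat \<Rightarrow> real \<Rightarrow> real) \<Rightarrow> real \<Rightarrow> real \<Rightarrow> complex mat" where
  "trotter_step N a b J \<Delta>t t =
     time_ordered_prod N
       (map (\<lambda>i. rot2 N a b i (2 * J a i t * \<Delta>t) (2 * J b i t * \<Delta>t)) (filter even [1..<N])) *
     time_ordered_prod N
       (map (\<lambda>i. rot2 N a b i (2 * J a i t * \<Delta>t) (2 * J b i t * \<Delta>t)) (filter odd [1..<N]))"

definition trotter_evolution ::
  "nat \<Rightarrow> pauli \<Rightarrow> pauli \<Rightarrow> (pauli \<Rightarrow> nat \<Rightarrow> real \<Rightarrow> real) \<Rightarrow> real \<Rightarrow> real \<Rightarrow> nat \<Rightarrow> complex mat" where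
  "trotter_evolution N a b J t0 \<Delta>t n =
     time_ordered_prod N (map (\<lambda>\<tau>. trotter_step N a b J \<Delta>t (t0 + real \<tau> * \<Delta>t)) [1..<n + 1])"

end

theory Submission imports Defs begin

text \<open>Each gate \<open>rot2\<close> factors into a gate of the chain \<open>P\<close> (bonds of type \<open>\<alpha>\<close> at odd, \<open>\<beta>\<close> at even
  positions) and one of the chain \<open>Q\<close> (types exchanged).  All bonds of \<open>P\<close> commute with all bonds of
  \<open>Q\<close>, while inside a chain neighbouring bonds anticommute and distant bonds commute.  By Euler angle
  decomposition the rotations of a chain satisfy a turnover law
  \<open>G\<^sub>i G\<^sub>i\<^sub>+\<^sub>1 G\<^sub>i = G\<^sub>i\<^sub>+\<^sub>1 G\<^sub>i G\<^sub>i\<^sub>+\<^sub>1\<close> of sets, besides fusion \<open>G\<^sub>i G\<^sub>i = G\<^sub>i\<close>.  Hence the set of operators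
  realised by a word of positions depends only on its class in the 0-Hecke monoid.  There the triangle
  word absorbs every generator, so it realises all circuits, and the brick wall of \<open>N\<close> layers equals
  it: the gates on the diagonal through the bottom corner form a cascade \<open>1, \<dots>, N - 1\<close>; pulling this
  cascade past the later gates shifts these by one position and leaves the brick wall on the
  positions \<open>2, \<dots>, N - 1\<close>, followed by the cascade.\<close>

section \<open>Words of positions up to fusion, commutation and turnover\<close>

text \<open>Equality in the 0-Hecke monoid of type A, generated as a congruence on words:
  \<open>append\<close> is compatibility with concatenation, the last three rules are the defining
  relations.\<close>

inductive hecke :: "nat list \<Rightarrow> nat list \<Rightarrow> bool"  (infix "\<approx>" 50) where
  refl [simp, intro]: "w \<approx> w"
| sym: "u \<approx> v \<Longrightarrow> v \<approx> u"
| trans [trans]: "u \<approx> v \<Longrightarrow> v \<approx> w \<Longrightarrow> u \<approx> w"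
| append: "u \<approx> u' \<Longrightarrow> v \<approx> v' \<Longrightarrow> u @ v \<approx> u' @ v'"
| idem: "[i, i] \<approx> [i]"
| comm: "i + 1 < j \<Longrightarrow> [i, j] \<approx> [j, i]"
| braid: "[i, i + 1, i] \<approx> [i + 1, i, i + 1]"

section \<open>Moving letters through words and cascades\<close>

lemma hecke_append_left: "u \<approx> v \<Longrightarrow> w @ u \<approx> w @ v"
  by (simp add: hecke.append)

lemma hecke_append_right: "u \<approx> v \<Longrightarrow> u @ w \<approx> v @ w"
  by (simp add: hecke.append)

lemma hecke_commute_word:
  assumes "\<forall>j\<in>set w. j + 1 < i \<or> i + 1 < j"
  shows "[i] @ w \<approx> w @ [i]"
  using assms
proof (induction w)
  case (Cons j w)
  have "[i, j] \<approx> [j, i]"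
    using Cons.prems hecke.comm hecke.sym by auto
  then have "[i, j] @ w \<approx> [j, i] @ w"
    by (rule hecke_append_right)
  also have "[j, i] @ w = [j] @ ([i] @ w)"
    by simp
  also have "\<dots> \<approx> [j] @ (w @ [i])"
    using Cons by (intro hecke_append_left) simp
  finally show ?case
    by simp
qed simp

text \<open>The letter \<open>i\<close> commutes back past \<open>i + 2, ..., n - 1\<close>, the
  braid relation turns \<open>i, i + 1, i\<close> into \<open>i + 1, i, i + 1\<close>, and the
  leading \<open>i + 1\<close> commutes past \<open>l, ..., i - 1\<close>.\<close>

lemma cascade_slide:
  assumes "l \<le> i" "i + 1 < n"
  shows "[l..<n] @ [i] \<approx> [i + 1] @ [l..<n]"
proof -
  have split: "[l..<n] = [l..<i] @ [i, i + 1] @ [i + 2..<n]"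
    using assms upt_add_eq_append[of l i "n - i"] by (simp add: upt_conv_Cons)
  have "[l..<n] @ [i] = ([l..<i] @ [i, i + 1]) @ ([i + 2..<n] @ [i])"
    by (simp add: split)
  also have "\<dots> \<approx> ([l..<i] @ [i, i + 1]) @ ([i] @ [i + 2..<n])"
    by (intro hecke_append_left hecke.sym[OF hecke_commute_word]) auto
  also have "\<dots> = [l..<i] @ ([i, i + 1, i] @ [i + 2..<n])"
    by simp
  also have "\<dots> \<approx> [l..<i] @ ([i + 1, i, i + 1] @ [i + 2..<n])"
    by (intro hecke_append_left hecke_append_right hecke.braid)
  also have "\<dots> = ([l..<i] @ [i + 1]) @ ([i, i + 1] @ [i + 2..<n])"
    by simp
  also have "\<dots> \<approx> ([i + 1] @ [l..<i]) @ ([i, i + 1] @ [i + 2..<n])"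
    by (intro hecke_append_right hecke.sym[OF hecke_commute_word]) auto
  also have "\<dots> = [i + 1] @ [l..<n]"
    by (simp add: split)
  finally show ?thesis .
qed

lemma cascade_slide_word:
  assumes "\<forall>i\<in>set w. l \<le> i \<and> i + 1 < n"
  shows "[l..<n] @ w \<approx> map Suc w @ [l..<n]"
  using assms
proof (induction w)
  case (Cons i w)
  have "[l..<n] @ [i] \<approx> [i + 1] @ [l..<n]"
    using Cons.prems by (intro cascade_slide) auto
  then have "([l..<n] @ [i]) @ w \<approx> ([i + 1] @ [l..<n]) @ w"
    by (rule hecke_append_right)
  also have "([i + 1] @ [l..<n]) @ w = [i + 1] @ ([l..<n] @ w)"
    by simp
  also have "\<dots> \<approx> [i + 1] @ (map Suc w @ [l..<n])"
    using Cons by (intro hecke_append_left) auto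
  finally show ?case
    by simp
qed simp

text \<open>A reduced word of the longest element of the symmetric group generated by the positions
  \<open>l, ..., n - 1\<close>. The lower end \<open>l\<close> is variable so that inductions can
  remove the last, longest cascade.\<close>

definition triangle_word :: "nat \<Rightarrow> nat \<Rightarrow> nat list" where
  "triangle_word l n = concat (map (\<lambda>k. [n - k..<n]) [1..<n - l + 1])"

lemma triangle_word_empty: "triangle_word n n = []"
  by (simp add: triangle_word_def)

lemma triangle_word_rec:
  assumes "l < n"
  shows "triangle_word l n = triangle_word (Suc l) n @ [l..<n]"
proof -
  have "[1..<n - l + 1] = [1..<n - Suc l + 1] @ [n - l]"
    using assms by (metis Suc_diff_Suc Suc_eq_plus1 upt_Suc_append Suc_le_mono le0 One_nat_def)
  then show ?thesis
    using assms by (simp add: triangle_word_def)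
qed

text \<open>Sliding through the last cascade raises \<open>i\<close> to \<open>i + 1\<close>, which
  the triangle on \<open>Suc l, ..., n - 1\<close> absorbs by induction. Only
  \<open>i = n - 1\<close> cannot slide; it fuses with the final letter of the cascade.\<close>

lemma triangle_word_absorb:
  assumes "l \<le> i" "i < n"
  shows "triangle_word l n @ [i] \<approx> triangle_word l n"
  using assms
proof (induction "n - l" arbitrary: l i)
  case (Suc k)
  have tri: "triangle_word l n = triangle_word (Suc l) n @ [l..<n]"
    using Suc.prems by (intro triangle_word_rec) simp
  show ?case
  proof (cases "i + 1 < n")
    case True
    have "triangle_word l n @ [i] = triangle_word (Suc l) n @ ([l..<n] @ [i])"
      by (simp add: tri)
    also have "\<dots> \<approx> triangle_word (Suc l) n @ ([i + 1] @ [l..<n])"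
      using Suc.prems True by (intro hecke_append_left cascade_slide)
    also have "\<dots> = (triangle_word (Suc l) n @ [i + 1]) @ [l..<n]"
      by simp
    also have "\<dots> \<approx> triangle_word (Suc l) n @ [l..<n]"
      using Suc True by (intro hecke_append_right Suc.hyps(1)) auto
    finally show ?thesis
      by (simp add: tri)
  next
    case False
    then have "n = Suc i"
      using Suc.prems by simp
    then have upt: "[l..<n] = [l..<i] @ [i]"
      using Suc.prems by simp
    have "triangle_word l n @ [i] = (triangle_word (Suc l) n @ [l..<i]) @ [i, i]"
      by (simp add: tri upt)
    also have "\<dots> \<approx> (triangle_word (Suc l) n @ [l..<i]) @ [i]"
      by (intro hecke_append_left hecke.idem)
    finally show ?thesis
      by (simp add: tri upt)
  qed
qed simp

lemma triangle_word_absorb_word: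
  assumes "set w \<subseteq> {l..<n}"
  shows "triangle_word l n @ w \<approx> triangle_word l n"
  using assms
proof (induction w)
  case (Cons i w)
  have "triangle_word l n @ (i # w) = (triangle_word l n @ [i]) @ w"
    by simp
  also have "\<dots> \<approx> triangle_word l n @ w"
    using Cons.prems by (intro hecke_append_right triangle_word_absorb) auto
  also have "\<dots> \<approx> triangle_word l n"
    using Cons by simp
  finally show ?case .
qed simp

text \<open>An event \<open>(i, t)\<close> is a gate at position \<open>i\<close> and time \<open>t\<close>.  Since events whose positions differ by
  at most one must have strictly increasing times, a list sorted by this relation has no repetitions.\<close>

definition causal :: "nat \<times> nat \<Rightarrow> nat \<times> nat \<Rightarrow> bool" where
  "causal e f \<longleftrightarrow> (fst e \<le> fst f + 1 \<and> fst f \<le> fst e + 1 \<longrightarrow> snd e < snd f)"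

text \<open>Let \<open>x\<close> be the head of \<open>xs\<close>. An event standing before
  \<open>x\<close> in \<open>ys\<close> stands after it in \<open>xs\<close>, so
  \<open>causal\<close> holds in both directions. Times cannot increase both ways, hence the
  positions are at least two apart and \<open>x\<close> commutes to the front of
  \<open>ys\<close>.\<close>

lemma hecke_causal_reorder:
  assumes "sorted_wrt causal xs" "sorted_wrt causal ys" "set xs = set ys"
  shows "map fst xs \<approx> map fst ys"
  using assms
proof (induction xs arbitrary: ys)
  case (Cons x xs)
  obtain y1 y2 where ys: "ys = y1 @ x # y2"
    using Cons.prems(3) by (metis list.set_intros(1) split_list)
  have irrefl: "\<not> causal x x"
    by (simp add: causal_def)
  have x: "x \<notin> set xs" "x \<notin> set y1" "x \<notin> set y2"
    using Cons.prems(1,2) irrefl by (auto simp: ys sorted_wrt_append)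
  have far: "\<forall>j\<in>set (map fst y1). j + 1 < fst x \<or> fst x + 1 < j"
  proof safe
    fix j assume "j \<in> set (map fst y1)" and j: "\<not> fst x + 1 < j"
    then obtain y where y: "y \<in> set y1" "j = fst y"
      by auto
    then have "y \<in> set xs"
      using x Cons.prems(3) by (auto simp: ys)
    then have "causal x y"
      using Cons.prems(1) by simp
    moreover have "causal y x"
      using y Cons.prems(2) by (simp add: ys sorted_wrt_append)
    ultimately show "j + 1 < fst x"
      using j y(2) by (auto simp: causal_def)
  qed
  have "map fst xs \<approx> map fst (y1 @ y2)"
    using Cons.prems x by (intro Cons.IH) (auto simp: ys sorted_wrt_append)
  then have "[fst x] @ map fst xs \<approx> [fst x] @ map fst (y1 @ y2)"
    by (rule hecke_append_left)
  also have "\<dots> = ([fst x] @ map fst y1) @ map fst y2"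
    by simp
  also have "\<dots> \<approx> (map fst y1 @ [fst x]) @ map fst y2"
    using far by (intro hecke_append_right hecke_commute_word)
  finally show ?case
    by (simp add: ys)
qed simp

section \<open>Brick walls and their reduction to triangles\<close>

definition layer_word :: "nat \<Rightarrow> nat \<Rightarrow> nat \<Rightarrow> nat list" where
  "layer_word l n p = filter (\<lambda>i. even (i + p)) [l..<n]"

text \<open>Layer \<open>t\<close> holds the positions of the parity of \<open>t + p\<close>, so
  \<open>p = 1\<close> makes the first layer odd.\<close>

definition brick_events :: "nat \<Rightarrow> nat \<Rightarrow> nat \<Rightarrow> nat \<Rightarrow> (nat \<times> nat) list" where
  "brick_events l n p T = concat (map (\<lambda>t. map (\<lambda>i. (i, t)) (layer_word l n (t + p))) [0..<T])"

lemma set_brick_events: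
  "(i, t) \<in> set (brick_events l n p T) \<longleftrightarrow> l \<le> i \<and> i < n \<and> t < T \<and> even (i + (t + p))"
  by (auto simp: brick_events_def layer_word_def)

lemma fst_brick_events:
  "map fst (brick_events l n p T) = concat (map (\<lambda>t. layer_word l n (t + p)) [0..<T])"
  by (simp add: brick_events_def map_concat comp_def)

text \<open>Equal parity keeps the positions of one layer two apart, where \<open>causal\<close> is
  vacuous; between layers time increases.\<close>

lemma sorted_brick_events: "sorted_wrt causal (brick_events l n p T)"
proof (induction T)
  case (Suc T)
  have "sorted_wrt (\<lambda>i j. i < j \<and> even (i + (T + p)) \<and> even (j + (T + p))) (layer_word l n (T + p))"
    unfolding layer_word_def
    by (rule sorted_wrt_mono_rel[where P = "(<)"]) (auto intro: sorted_wrt_filter)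
  then have "sorted_wrt causal (map (\<lambda>i. (i, T)) (layer_word l n (T + p)))"
    unfolding sorted_wrt_map
    by (rule sorted_wrt_mono_rel[rotated]) (simp add: causal_def, presburger)
  moreover have "causal e f" if "e \<in> set (brick_events l n p T)" "snd f = T" for e f
    using that set_brick_events[of "fst e" "snd e" l n p T] by (simp add: causal_def)
  moreover have "brick_events l n p (Suc T) =
      brick_events l n p T @ map (\<lambda>i. (i, T)) (layer_word l n (T + p))"
    by (simp add: brick_events_def)
  ultimately show ?case
    using Suc by (auto simp: sorted_wrt_append)
qed (simp add: brick_events_def)

text \<open>The wall is cut along a diagonal running from position \<open>l\<close> to position
  \<open>n - 1\<close>. Sliding the later events through this cascade raises their positions by one;
  relabelled one time step earlier they fill exactly the gap that the diagonal leaves. The extra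
  layer makes room for the whole diagonal even if it starts at time 1.\<close>

lemma brick_word_rec:
  assumes "l < n"
  shows "map fst (brick_events l n p (n - l + 1)) \<approx>
    map fst (brick_events (Suc l) n p (n - l)) @ [l..<n]"
proof -
  \<comment> \<open>The diagonal consists of the events with \<open>t = i + c - l\<close>.\<close>
  define c where "c = (l + p) mod 2"
  \<comment> \<open>\<open>c\<close> is the time of the first gate at position \<open>l\<close>: 0
    if the layer at time 0 contains \<open>l\<close>, otherwise 1.\<close>
  have c: "c \<le> 1" "even (l + p + c)"
    unfolding c_def by presburger+
  define E where "E = brick_events l n p (n - l + 1)"
  define before where "before = filter (\<lambda>(i, t). t + l < i + c) E"
  define diagonal where "diagonal = map (\<lambda>i. (i, i + c - l)) [l..<n]"
  define after where "after = filter (\<lambda>(i, t). i + c < t + l) E"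
  \<comment> \<open>The move of a later event under the slide. Later events have
    \<open>t \<ge> 2\<close>, so the truncated subtraction is exact.\<close>
  define shift :: "nat \<times> nat \<Rightarrow> nat \<times> nat" where "shift = (\<lambda>(i, t). (i + 1, t - 1))"
  have E: "(i, t) \<in> set E \<longleftrightarrow> l \<le> i \<and> i < n \<and> t \<le> n - l \<and> even (i + (t + p))" for i t
    by (auto simp: E_def set_brick_events)
  \<comment> \<open>All events of the wall lie an even distance in time from the diagonal. Being off
    it by at least two is what makes the three pieces causally ordered.\<close>
  have parity: "t + l < i + c \<longleftrightarrow> t + l + 2 \<le> i + c" "i + c < t + l \<longleftrightarrow> i + c + 2 \<le> t + l"
    if "even (i + (t + p))" for i t
    using that c(2) by presburger+
  have in_before: "(i, t) \<in> set before \<longleftrightarrow>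
      l \<le> i \<and> i < n \<and> t \<le> n - l \<and> even (i + (t + p)) \<and> t + l + 2 \<le> i + c" for i t
    unfolding before_def using E[of i t] parity(1)[of i t] by auto
  have in_diagonal: "(i, t) \<in> set diagonal \<longleftrightarrow> l \<le> i \<and> i < n \<and> t + l = i + c" for i t
    by (auto simp: diagonal_def)
  have in_after: "(i, t) \<in> set after \<longleftrightarrow>
      l \<le> i \<and> i < n \<and> t \<le> n - l \<and> even (i + (t + p)) \<and> i + c + 2 \<le> t + l" for i t
    unfolding after_def using E[of i t] parity(2)[of i t] by auto
  have sorted: "sorted_wrt causal E"
    by (simp add: E_def sorted_brick_events)
  have sorted_diagonal: "sorted_wrt causal diagonal"
    unfolding diagonal_def sorted_wrt_map
    by (rule sorted_wrt_mono_rel[where P = "(<)"]) (auto simp: causal_def)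
  have "map fst E \<approx> map fst (before @ diagonal @ after)"
  proof (rule hecke_causal_reorder[OF sorted])
    have "causal e f" if "e \<in> set before" "f \<in> set diagonal" for e f
      using that in_before[of "fst e" "snd e"] in_diagonal[of "fst f" "snd f"]
      by (simp add: causal_def)
    moreover have "causal e f" if "e \<in> set before" "f \<in> set after" for e f
      using that in_before[of "fst e" "snd e"] in_after[of "fst f" "snd f"]
      by (simp add: causal_def)
    moreover have "causal e f" if "e \<in> set diagonal" "f \<in> set after" for e f
      using that in_diagonal[of "fst e" "snd e"] in_after[of "fst f" "snd f"]
      by (simp add: causal_def)
    ultimately show "sorted_wrt causal (before @ diagonal @ after)"
      using sorted sorted_diagonal
      by (auto simp: sorted_wrt_append before_def after_def intro!: sorted_wrt_filter)
    have "e \<in> set E \<longleftrightarrow> e \<in> set (before @ diagonal @ after)" for e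
    proof (cases e)
      case (Pair i t)
      have "even (i + (t + p))" if "t + l = i + c"
        using that c(2) by presburger
      then show ?thesis
        unfolding Pair set_append Un_iff E in_before in_diagonal in_after
        using c(1) assms parity[of i t] by (auto simp del: even_add)
    qed
    then show "set E = set (before @ diagonal @ after)"
      by blast
  qed
  also have "map fst (before @ diagonal @ after) = map fst before @ ([l..<n] @ map fst after)"
    by (simp add: diagonal_def comp_def)
  also have "\<dots> \<approx> map fst before @ (map Suc (map fst after) @ [l..<n])"
  proof (intro hecke_append_left cascade_slide_word ballI)
    fix i assume "i \<in> set (map fst after)"
    then obtain t where "(i, t) \<in> set after"
      by auto
    \<comment> \<open>The last layer has time \<open>n - l\<close>, and a later event satisfies
      \<open>i + c + 2 \<le> t + l\<close>; together they keep \<open>i\<close> below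
      \<open>n - 1\<close>, where the cascade can still slide.\<close>
    then show "l \<le> i \<and> i + 1 < n"
      unfolding in_after using assms by linarith
  qed
  also have "\<dots> = map fst (before @ map shift after) @ [l..<n]"
    by (simp add: shift_def comp_def case_prod_unfold)
  also have "\<dots> \<approx> map fst (brick_events (Suc l) n p (n - l)) @ [l..<n]"
  proof (intro hecke_append_right hecke_causal_reorder sorted_brick_events)
    have "sorted_wrt causal after"
      using sorted by (simp add: after_def sorted_wrt_filter)
    then have "sorted_wrt causal (map shift after)"
      unfolding sorted_wrt_map
    proof (rule sorted_wrt_mono_rel[rotated])
      fix e f assume "e \<in> set after" "f \<in> set after" "causal e f"
      then show "causal (shift e) (shift f)"
        using in_after[of "fst e" "snd e"]
        by (simp add: causal_def shift_def case_prod_unfold, linarith)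
    qed
    moreover have "causal e (shift f)" if "e \<in> set before" "f \<in> set after" for e f
      using that in_before[of "fst e" "snd e"] in_after[of "fst f" "snd f"]
      by (simp add: causal_def shift_def case_prod_unfold, linarith)
    moreover have "sorted_wrt causal before"
      using sorted by (simp add: before_def sorted_wrt_filter)
    ultimately show "sorted_wrt causal (before @ map shift after)"
      by (auto simp: sorted_wrt_append)
    have "(i, t) \<in> shift ` set after \<longleftrightarrow> 1 \<le> i \<and> (i - 1, t + 1) \<in> set after" for i t
    proof
      assume "(i, t) \<in> shift ` set after"
      then obtain i' t' where "(i', t') \<in> set after" "i = i' + 1" "t = t' - 1"
        by (auto simp: shift_def)
      moreover from this(1) have "t' \<ge> 1"
        unfolding in_after by linarith
      ultimately show "1 \<le> i \<and> (i - 1, t + 1) \<in> set after"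
        by simp
    next
      assume "1 \<le> i \<and> (i - 1, t + 1) \<in> set after"
      then show "(i, t) \<in> shift ` set after"
        by (intro image_eqI[of _ _ "(i - 1, t + 1)"]) (auto simp: shift_def)
    qed
    note in_shift = this
    have "e \<in> set (before @ map shift after) \<longleftrightarrow> e \<in> set (brick_events (Suc l) n p (n - l))" for e
    proof (cases e)
      case (Pair i t)
      show ?thesis
      proof (cases i)
        case 0
        then show ?thesis
          unfolding Pair set_append set_map Un_iff in_before in_shift set_brick_events
          using c(1) by simp
      next
        case (Suc j)
        \<comment> \<open>Earlier events form the side \<open>t + l < i + c\<close> of the smaller
          wall, shifted later events the complementary side \<open>i + c \<le> t + l\<close>. The
          facts collected here supply the parity and the bounds on either side.\<close>
        have "even (j + (t + 1 + p)) \<longleftrightarrow> even (i + (t + p))"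
          using Suc by simp
        moreover have "t < n - l \<longleftrightarrow> t + 1 \<le> n - l" "j + c + 2 \<le> t + 1 + l \<longleftrightarrow> i + c \<le> t + l"
          using Suc by auto
        moreover have "t + 1 \<le> n - l" if "i < n" "t + l + 2 \<le> i + c"
          using that c(1) by linarith
        moreover have "i < n" if "t + 1 \<le> n - l" "i + c \<le> t + l"
          using that assms by linarith
        moreover have "t \<le> n - l" if "t + 1 \<le> n - l"
          using that by simp
        moreover have "i + c \<le> t + l \<longleftrightarrow> \<not> t + l < i + c" "j < n" if "i < n"
          using that Suc by auto
        moreover have "l + 1 \<le> i" if "t + l + 2 \<le> i + c"
          using that c(1) by linarith
        moreover have "Suc l \<le> i \<longleftrightarrow> l + 1 \<le> i" "l + 1 \<le> i \<longleftrightarrow> l \<le> j" "1 \<le> i" "i - 1 = j"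
          using Suc by auto
        moreover have "l \<le> i" if "l + 1 \<le> i"
          using that by simp
        ultimately show ?thesis
          unfolding Pair set_append set_map Un_iff in_before in_shift in_after set_brick_events
          using parity(1)[of i t] by metis
      qed
    qed
    then show "set (before @ map shift after) = set (brick_events (Suc l) n p (n - l))"
      by blast
  qed
  finally show ?thesis
    by (simp add: E_def)
qed

lemma brick_word_triangle_word:
  assumes "l \<le> n"
  shows "map fst (brick_events l n p (n - l + 1)) \<approx> triangle_word l n"
  using assms
proof (induction "n - l" arbitrary: l)
  case 0
  then show ?case
    by (simp add: brick_events_def layer_word_def triangle_word_empty)
next
  case (Suc k)
  then have l: "l < n"
    by simp
  then have "n - l = n - Suc l + 1"
    by simp
  then have "map fst (brick_events (Suc l) n p (n - l)) \<approx> triangle_word (Suc l) n"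
    using Suc.hyps(1)[of "Suc l"] Suc.hyps(2) l by simp
  then have "map fst (brick_events (Suc l) n p (n - l)) @ [l..<n] \<approx> triangle_word (Suc l) n @ [l..<n]"
    by (rule hecke_append_right)
  then show ?case
    using brick_word_rec[OF l] triangle_word_rec[OF l] hecke.trans by auto
qed

section \<open>Spin operators and their rotations\<close>

lemma dim_kron [simp]:
  "dim_row (kron A B) = dim_row A * dim_row B" "dim_col (kron A B) = dim_col A * dim_col B"
  by (simp_all add: kron_def)

lemma kron_carrier [intro]:
  "A \<in> carrier_mat a b \<Longrightarrow> B \<in> carrier_mat c d \<Longrightarrow> kron A B \<in> carrier_mat (a * c) (b * d)"
  by (rule carrier_matI) auto

lemma index_kron [simp]:
  assumes "i < dim_row A * dim_row B" "j < dim_col A * dim_col B"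
  shows "kron A B $$ (i, j) =
    A $$ (i div dim_row B, j div dim_col B) * B $$ (i mod dim_row B, j mod dim_col B)"
  using assms by (simp add: kron_def)

lemma div_mod_less:
  assumes "i < a * (b :: nat)"
  shows "i div b < a" "i mod b < b"
  using assms by (cases "b = 0"; simp add: less_mult_imp_div_less)+

lemma div_mod_mult:
  fixes i b c :: nat
  shows "i div (b * c) = i div c div b" "i mod (b * c) div c = i div c mod b"
    "i mod (b * c) mod c = i mod c"
proof -
  have "i mod (b * c) = c * (i div c mod b) + i mod c"
    by (simp only: mult.commute[of b c] mod_mult2_eq)
  then show "i mod (b * c) div c = i div c mod b"
    by (cases "c = 0") auto
qed (simp_all add: div_mult2_eq mult.commute[of b c] mod_mod_cancel)

lemma kron_assoc: "kron (kron A B) C = kron A (kron B C)"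
proof (rule eq_matI)
  fix i j assume "i < dim_row (kron A (kron B C))" "j < dim_col (kron A (kron B C))"
  then have i: "i < (dim_row A * dim_row B) * dim_row C" "i < dim_row A * (dim_row B * dim_row C)"
    and j: "j < (dim_col A * dim_col B) * dim_col C" "j < dim_col A * (dim_col B * dim_col C)"
    by (simp_all add: mult.assoc)
  show "kron (kron A B) C $$ (i, j) = kron A (kron B C) $$ (i, j)"
    using i j div_mod_less[OF i(1)] div_mod_less[OF j(1)] div_mod_less[OF i(2)] div_mod_less[OF j(2)]
    by (simp add: div_mod_mult)
qed (simp_all add: mult.assoc)

lemma kron_one: "kron (1\<^sub>m m) (1\<^sub>m n) = 1\<^sub>m (m * n)"
proof (rule eq_matI)
  fix i j assume "i < dim_row (1\<^sub>m (m * n) :: complex mat)" "j < dim_col (1\<^sub>m (m * n) :: complex mat)"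
  then have i: "i < m * n" and j: "j < m * n"
    by simp_all
  have "i = j \<longleftrightarrow> i div n = j div n \<and> i mod n = j mod n"
    by (metis div_mult_mod_eq)
  then show "kron (1\<^sub>m m) (1\<^sub>m n) $$ (i, j) = 1\<^sub>m (m * n) $$ (i, j)"
    using i j div_mod_less[OF i] div_mod_less[OF j] by auto
qed simp_all

lemma sum_div_mod:
  fixes g :: "nat \<Rightarrow> nat \<Rightarrow> 'a :: comm_monoid_add"
  shows "(\<Sum>k = 0..<b * d. g (k div d) (k mod d)) = (\<Sum>p = 0..<b. \<Sum>q = 0..<d. g p q)"
  unfolding sum.cartesian_product
  by (rule sum.reindex_bij_witness[where i = "\<lambda>(p, q). p * d + q" and j = "\<lambda>k. (k div d, k mod d)"])
    (auto simp: div_mod_less, metis add.commute less_mult_imp_div_less div_mult_self3 div_less add_0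
      mult.commute div_less_iff_less_mult gr_zeroI less_nat_zero_code)

lemma kron_mult:
  assumes "A \<in> carrier_mat a b" "B \<in> carrier_mat c d" "C \<in> carrier_mat b e" "D \<in> carrier_mat d f"
  shows "kron A B * kron C D = kron (A * C) (B * D)"
proof (rule eq_matI)
  fix i j assume "i < dim_row (kron (A * C) (B * D))" "j < dim_col (kron (A * C) (B * D))"
  then have i: "i < a * c" and j: "j < e * f"
    using assms by simp_all
  define g where "g p q = (A $$ (i div c, p) * C $$ (p, j div f)) *
      (B $$ (i mod c, q) * D $$ (q, j mod f))" for p q
  have "(kron A B * kron C D) $$ (i, j) = (\<Sum>k = 0..<b * d. kron A B $$ (i, k) * kron C D $$ (k, j))"
    using assms i j by (auto simp: scalar_prod_def intro!: sum.cong)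
  also have "\<dots> = (\<Sum>k = 0..<b * d. g (k div d) (k mod d))"
    using assms i j by (intro sum.cong) (auto simp: g_def)
  also have "\<dots> = (\<Sum>p = 0..<b. A $$ (i div c, p) * C $$ (p, j div f)) *
      (\<Sum>q = 0..<d. B $$ (i mod c, q) * D $$ (q, j mod f))"
    unfolding sum_div_mod by (simp add: g_def sum_product)
  also have "\<dots> = kron (A * C) (B * D) $$ (i, j)"
    using assms i j div_mod_less[OF i] div_mod_less[OF j] by (simp add: scalar_prod_def)
  finally show "(kron A B * kron C D) $$ (i, j) = kron (A * C) (B * D) $$ (i, j)" .
qed (use assms in simp_all)

lemma kron_smult: "kron (s \<cdot>\<^sub>m A) B = s \<cdot>\<^sub>m kron A B" "kron A (s \<cdot>\<^sub>m B) = s \<cdot>\<^sub>m kron A B"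
  by (rule eq_matI; auto simp: div_mod_less)+

text \<open>Tracking commutation and anticommutation by a scalar lets the signs of bond products multiply
  up from the four pairs of spins.\<close>

definition swaps :: "complex \<Rightarrow> complex mat \<Rightarrow> complex mat \<Rightarrow> bool" where
  "swaps s A B \<longleftrightarrow> A * B = s \<cdot>\<^sub>m (B * A)"

lemma smult_smult_mat: "s \<cdot>\<^sub>m (t \<cdot>\<^sub>m A) = (s * t) \<cdot>\<^sub>m (A :: complex mat)"
  by (rule eq_matI) auto

lemma smult_one_mat [simp]: "1 \<cdot>\<^sub>m A = (A :: complex mat)"
  by (rule eq_matI) auto

lemma swaps_mult_right:
  assumes "A \<in> carrier_mat n n" "B \<in> carrier_mat n n" "C \<in> carrier_mat n n" "swaps s A B" "swaps t A C"
  shows "swaps (s * t) A (B * C)"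
proof -
  have "A * (B * C) = (s \<cdot>\<^sub>m (B * A)) * C"
    using assms by (simp add: swaps_def flip: assoc_mult_mat[of _ n n _ n _ n])
  also have "\<dots> = s \<cdot>\<^sub>m (B * (t \<cdot>\<^sub>m (C * A)))"
    using assms by (simp add: swaps_def mult_smult_assoc_mat[of _ n n _ n] assoc_mult_mat[of _ n n _ n _ n])
  also have "\<dots> = (s * t) \<cdot>\<^sub>m (B * C * A)"
    using assms by (simp add: mult_smult_distrib[of _ n n _ n] smult_smult_mat assoc_mult_mat[of _ n n _ n _ n])
  finally show ?thesis
    by (simp add: swaps_def)
qed

lemma swaps_mult_left:
  assumes "A \<in> carrier_mat n n" "B \<in> carrier_mat n n" "C \<in> carrier_mat n n" "swaps s A C" "swaps t B C"
  shows "swaps (s * t) (A * B) C"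
proof -
  have "A * B * C = A * (t \<cdot>\<^sub>m (C * B))"
    using assms by (simp add: swaps_def assoc_mult_mat[of _ n n _ n _ n])
  also have "\<dots> = t \<cdot>\<^sub>m ((s \<cdot>\<^sub>m (C * A)) * B)"
    using assms by (simp add: swaps_def mult_smult_distrib[of _ n n _ n] flip: assoc_mult_mat[of _ n n _ n _ n])
  also have "\<dots> = (s * t) \<cdot>\<^sub>m (C * (A * B))"
    using assms by (simp add: mult_smult_assoc_mat[of _ n n _ n] smult_smult_mat assoc_mult_mat[of _ n n _ n _ n] mult.commute)
  finally show ?thesis
    by (simp add: swaps_def)
qed

section \<open>Commutation signs of Pauli matrices, spin operators and bonds\<close>

lemma pauli_mat_carrier [simp, intro]: "pauli_mat a \<in> carrier_mat 2 2"
  by (cases a) (auto simp: mat_of_rows_list_def)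

lemma pauli_mat_square: "pauli_mat a * pauli_mat a = 1\<^sub>m 2"
  by (cases a; intro eq_matI)
    (auto simp: mat_of_rows_list_def scalar_prod_def numeral_2_eq_2 less_Suc_eq)

lemma swaps_pauli_mat: "a \<noteq> b \<Longrightarrow> swaps (- 1) (pauli_mat a) (pauli_mat b)"
  unfolding swaps_def
  by (cases a; cases b; simp; intro eq_matI)
    (auto simp: mat_of_rows_list_def scalar_prod_def numeral_2_eq_2 less_Suc_eq)

context
  fixes N i :: nat
  assumes i: "1 \<le> i" "i \<le> N"
begin

lemma spin_op_dim: "2 ^ (i - 1) * 2 * 2 ^ (N - i) = (2 ^ N :: nat)"
proof -
  have "2 ^ (i - 1) * 2 * 2 ^ (N - i) = (2 :: nat) ^ (i - 1 + 1 + (N - i))"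
    by (simp only: power_add power_one_right)
  then show ?thesis
    using i by simp
qed

lemma spin_op_carrier: "spin_op N a i \<in> carrier_mat (2 ^ N) (2 ^ N)"
  using kron_carrier[OF kron_carrier[OF one_carrier_mat pauli_mat_carrier] one_carrier_mat]
  unfolding spin_op_def spin_op_dim[symmetric] by blast

lemma spin_op_mult:
  "spin_op N a i * spin_op N b i =
    kron (kron (1\<^sub>m (2 ^ (i - 1))) (pauli_mat a * pauli_mat b)) (1\<^sub>m (2 ^ (N - i)))"
proof -
  let ?k = "2 ^ (i - 1) :: nat"
  have "spin_op N a i * spin_op N b i = kron (kron (1\<^sub>m ?k) (pauli_mat a) * kron (1\<^sub>m ?k) (pauli_mat b))
      (1\<^sub>m (2 ^ (N - i)) * 1\<^sub>m (2 ^ (N - i)))"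
    unfolding spin_op_def
    by (rule kron_mult[of _ "?k * 2" "?k * 2" _ _ _ _ "?k * 2"]) (auto intro!: kron_carrier)
  also have "kron (1\<^sub>m ?k) (pauli_mat a) * kron (1\<^sub>m ?k) (pauli_mat b) =
      kron (1\<^sub>m ?k * 1\<^sub>m ?k) (pauli_mat a * pauli_mat b)"
    by (rule kron_mult[of _ ?k ?k _ 2 2 _ ?k _ 2]) auto
  finally show ?thesis
    by simp
qed

lemma spin_op_square: "spin_op N a i * spin_op N a i = 1\<^sub>m (2 ^ N)"
  by (simp add: spin_op_mult pauli_mat_square kron_one spin_op_dim[simplified])

lemma swaps_spin_op_same:
  assumes "a \<noteq> b"
  shows "swaps (- 1) (spin_op N a i) (spin_op N b i)"
  using swaps_pauli_mat[OF assms] by (simp add: swaps_def spin_op_mult kron_smult)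

text \<open>Cutting the chain behind spin \<open>i\<close> presents the operators as
  \<open>P\<close> on the first \<open>i\<close> spins and \<open>Q\<close> on the remaining ones;
  either product is then \<open>kron P Q\<close>.\<close>

lemma swaps_spin_op_less:
  assumes "i < j" "j \<le> N"
  shows "swaps 1 (spin_op N a i) (spin_op N b j)" "swaps 1 (spin_op N b j) (spin_op N a i)"
proof -
  define P where "P = kron (1\<^sub>m (2 ^ (i - 1))) (pauli_mat a)"
  define Q where "Q = kron (kron (1\<^sub>m (2 ^ (j - i - 1))) (pauli_mat b)) (1\<^sub>m (2 ^ (N - j)))"
  have "2 ^ (i - 1) * 2 = (2 ^ i :: nat)"
    using i by (simp flip: power_Suc2)
  then have P: "P \<in> carrier_mat (2 ^ i) (2 ^ i)"
    unfolding P_def using kron_carrier[OF one_carrier_mat pauli_mat_carrier] by metis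
  have dim: "2 ^ (j - i - 1) * 2 * 2 ^ (N - j) = (2 ^ (N - i) :: nat)"
    "2 ^ i * 2 ^ (j - i - 1) = (2 ^ (j - 1) :: nat)"
  proof -
    have "2 ^ (j - i - 1) * 2 * 2 ^ (N - j) = (2 :: nat) ^ (j - i - 1 + 1 + (N - j))"
      by (simp only: power_add power_one_right)
    also have "j - i - 1 + 1 + (N - j) = N - i"
      using assms by simp
    finally show "2 ^ (j - i - 1) * 2 * 2 ^ (N - j) = (2 ^ (N - i) :: nat)" .
    have "i + (j - i - 1) = j - 1"
      using assms by simp
    then show "2 ^ i * 2 ^ (j - i - 1) = (2 ^ (j - 1) :: nat)"
      by (simp flip: power_add)
  qed
  have Q: "Q \<in> carrier_mat (2 ^ (N - i)) (2 ^ (N - i))"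
    unfolding Q_def dim(1)[symmetric] by (auto intro!: kron_carrier)
  have spin: "spin_op N a i = kron P (1\<^sub>m (2 ^ (N - i)))" "spin_op N b j = kron (1\<^sub>m (2 ^ i)) Q"
    by (simp_all add: spin_op_def P_def Q_def dim(2)[simplified] kron_one flip: kron_assoc)
  have "spin_op N a i * spin_op N b j = kron P Q" "spin_op N b j * spin_op N a i = kron P Q"
    unfolding spin using P Q by (simp_all add: kron_mult[of _ "2 ^ i" "2 ^ i" _ "2 ^ (N - i)" "2 ^ (N - i)" _ "2 ^ i" _ "2 ^ (N - i)"])
  then show "swaps 1 (spin_op N a i) (spin_op N b j)" "swaps 1 (spin_op N b j) (spin_op N a i)"
    by (simp_all add: swaps_def)
qed

end

definition spin_sign :: "pauli \<Rightarrow> nat \<Rightarrow> pauli \<Rightarrow> nat \<Rightarrow> complex" where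
  "spin_sign a i b j = (if i = j \<and> a \<noteq> b then - 1 else 1)"

lemma swaps_spin_op:
  assumes "1 \<le> i" "i \<le> N" "1 \<le> j" "j \<le> N"
  shows "swaps (spin_sign a i b j) (spin_op N a i) (spin_op N b j)"
proof (cases i j rule: linorder_cases)
  case equal
  then show ?thesis
    using assms swaps_spin_op_same by (auto simp: spin_sign_def) (simp add: swaps_def)
qed (use assms swaps_spin_op_less in \<open>auto simp: spin_sign_def\<close>)

definition bond :: "nat \<Rightarrow> pauli \<Rightarrow> nat \<Rightarrow> complex mat" where
  "bond N a i = spin_op N a i * spin_op N a (i + 1)"

lemma bond_carrier:
  assumes "1 \<le> i" "i < N"
  shows "bond N a i \<in> carrier_mat (2 ^ N) (2 ^ N)"
  unfolding bond_def using assms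
  by (intro mult_carrier_mat[where n = "2 ^ N"] spin_op_carrier) auto

text \<open>For equal types all four signs are 1. For different types every shared spin contributes
  \<open>- 1\<close>: bonds at the same position share two spins and commute, neighbouring bonds
  share one and anticommute, distant bonds share none.\<close>

lemma swaps_bond:
  assumes "1 \<le> i" "i < N" "1 \<le> j" "j < N"
  shows "swaps (spin_sign a i b j * spin_sign a i b (j + 1) *
      (spin_sign a (i + 1) b j * spin_sign a (i + 1) b (j + 1))) (bond N a i) (bond N b j)"
proof -
  have "spin_op N c k \<in> carrier_mat (2 ^ N) (2 ^ N)" if "1 \<le> k" "k \<le> N" for c k
    using that by (rule spin_op_carrier)
  then show ?thesis
    unfolding bond_def using assms
    by (intro swaps_mult_left[where n = "2 ^ N"] swaps_mult_right[where n = "2 ^ N"]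
        mult_carrier_mat[where n = "2 ^ N"] swaps_spin_op) auto
qed

lemma bond_square:
  assumes "1 \<le> i" "i < N"
  shows "bond N a i * bond N a i = 1\<^sub>m (2 ^ N)"
proof -
  let ?n = "2 ^ N :: nat" and ?X = "spin_op N a i" and ?Y = "spin_op N a (i + 1)"
  have c: "?X \<in> carrier_mat ?n ?n" "?Y \<in> carrier_mat ?n ?n"
    using assms by (auto intro!: spin_op_carrier)
  have "?X * ?Y * (?X * ?Y) = ?X * (?Y * ?X) * ?Y"
    using c by (simp add: assoc_mult_mat[of _ ?n ?n _ ?n _ ?n])
  also have "?Y * ?X = ?X * ?Y"
    using assms swaps_spin_op[of "i + 1" N i a a] by (simp add: swaps_def spin_sign_def)
  also have "?X * (?X * ?Y) * ?Y = (?X * ?X) * (?Y * ?Y)"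
    using c by (simp add: assoc_mult_mat[of _ ?n ?n _ ?n _ ?n])
  also have "\<dots> = 1\<^sub>m ?n"
    using assms by (simp add: spin_op_square)
  finally show ?thesis
    by (simp add: bond_def)
qed

section \<open>Rotations generated by an involution, in closed form\<close>

definition rotor :: "nat \<Rightarrow> complex mat \<Rightarrow> real \<Rightarrow> complex mat" where
  "rotor n X a = complex_of_real (cos a) \<cdot>\<^sub>m 1\<^sub>m n + (- \<i> * complex_of_real (sin a)) \<cdot>\<^sub>m X"

text \<open>Even powers are multiples of the identity and odd ones of \<open>X\<close>. The half sum
  and half difference of \<open>c ^ k\<close> and \<open>(- c) ^ k\<close> select the parity without
  a case distinction, and when summed they give the even and odd parts of \<open>exp c\<close>, here
  a cosine and a sine.\<close>

lemma pow_mat_involution: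
  fixes X :: "complex mat"
  assumes "X \<in> carrier_mat n n" "X * X = 1\<^sub>m n"
  shows "(c \<cdot>\<^sub>m X) ^\<^sub>m k = ((c ^ k + (- c) ^ k) / 2) \<cdot>\<^sub>m 1\<^sub>m n + ((c ^ k - (- c) ^ k) / 2) \<cdot>\<^sub>m X"
    (is "_ = ?p k \<cdot>\<^sub>m _ + ?q k \<cdot>\<^sub>m _")
proof (induction k)
  case 0
  then show ?case
    using assms by (intro eq_matI) auto
next
  case (Suc k)
  have "(?p k \<cdot>\<^sub>m 1\<^sub>m n + ?q k \<cdot>\<^sub>m X) * (c \<cdot>\<^sub>m X) = (c * ?p k) \<cdot>\<^sub>m X + (c * ?q k) \<cdot>\<^sub>m 1\<^sub>m n"
    using assms by (simp add: add_mult_distrib_mat[of _ n n _ _ n] mult_smult_assoc_mat[of _ n n _ n]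
        mult_smult_distrib[of _ n n _ n] smult_smult_mat mult.commute
        add_smult_distrib_left_mat[of _ n n])
  also have "\<dots> = ?p (Suc k) \<cdot>\<^sub>m 1\<^sub>m n + ?q (Suc k) \<cdot>\<^sub>m X"
    using assms by (intro eq_matI) (auto simp: field_simps)
  finally show ?case
    by (simp add: Suc)
qed

lemma mat_exp_involution:
  assumes "X \<in> carrier_mat n n" "X * X = 1\<^sub>m n"
  shows "mat_exp ((- \<i> * complex_of_real a) \<cdot>\<^sub>m X) = rotor n X a"
proof (rule eq_matI)
  fix r s assume "r < dim_row (rotor n X a)" "s < dim_col (rotor n X a)"
  then have rs: "r < n" "s < n"
    using assms by (simp_all add: rotor_def)
  define c where "c = - \<i> * complex_of_real a"
  have exp: "(exp c + exp (- c)) / 2 = complex_of_real (cos a)"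
    "(exp c - exp (- c)) / 2 = - \<i> * complex_of_real (sin a)"
  proof -
    have "exp c = cis (- a)" "exp (- c) = cis a"
      by (simp_all add: c_def cis_conv_exp)
    then show "(exp c + exp (- c)) / 2 = complex_of_real (cos a)"
      "(exp c - exp (- c)) / 2 = - \<i> * complex_of_real (sin a)"
      by (simp_all add: complex_eq_iff)
  qed
  have "(\<lambda>k. c ^ k / fact k) sums exp c" "(\<lambda>k. (- c) ^ k / fact k) sums exp (- c)"
    using exp_converges[of c] exp_converges[of "- c"] by (simp_all add: scaleR_conv_of_real field_simps)
  note sums = this
  have "(\<lambda>k. ((c ^ k / fact k + (- c) ^ k / fact k) / 2) * 1\<^sub>m n $$ (r, s) +
      ((c ^ k / fact k - (- c) ^ k / fact k) / 2) * X $$ (r, s)) sums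
      ((exp c + exp (- c)) / 2 * 1\<^sub>m n $$ (r, s) + (exp c - exp (- c)) / 2 * X $$ (r, s))"
    by (intro sums_add sums_mult2 sums_divide sums_diff sums)
  also have "(\<lambda>k. ((c ^ k / fact k + (- c) ^ k / fact k) / 2) * 1\<^sub>m n $$ (r, s) +
      ((c ^ k / fact k - (- c) ^ k / fact k) / 2) * X $$ (r, s)) = (\<lambda>k. ((c \<cdot>\<^sub>m X) ^\<^sub>m k) $$ (r, s) / fact k)"
  proof
    fix k
    have "(p / f + q / f) / 2 * u + (p / f - q / f) / 2 * v = ((p + q) / 2 * u + (p - q) / 2 * v) / f"
      for p q f u v :: complex
      by (simp add: add_divide_distrib diff_divide_distrib distrib_left distrib_right
          left_diff_distrib mult.commute[of f])
    then show "((c ^ k / fact k + (- c) ^ k / fact k) / 2) * 1\<^sub>m n $$ (r, s) +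
      ((c ^ k / fact k - (- c) ^ k / fact k) / 2) * X $$ (r, s) = ((c \<cdot>\<^sub>m X) ^\<^sub>m k) $$ (r, s) / fact k"
      unfolding pow_mat_involution[OF assms] using assms(1) rs by simp
  qed
  finally have "(\<Sum>k. ((c \<cdot>\<^sub>m X) ^\<^sub>m k) $$ (r, s) / fact k) = rotor n X a $$ (r, s)"
    unfolding exp using assms rs by (simp add: rotor_def sums_iff)
  then show "mat_exp ((- \<i> * complex_of_real a) \<cdot>\<^sub>m X) $$ (r, s) = rotor n X a $$ (r, s)"
    using assms rs by (simp add: mat_exp_def c_def)
qed (use assms in \<open>simp_all add: mat_exp_def rotor_def\<close>)

lemma rot_eq_rotor:
  assumes "1 \<le> i" "i < N"
  shows "rot N a i \<theta> = rotor (2 ^ N) (bond N a i) (\<theta> / 2)"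
  unfolding rot_def bond_def[symmetric] using assms
  by (intro mat_exp_involution bond_carrier bond_square)

lemma rotor_carrier:
  "X \<in> carrier_mat n n \<Longrightarrow> rotor n X a \<in> carrier_mat n n"
  by (simp add: rotor_def)

lemma rotor_0: "X \<in> carrier_mat n n \<Longrightarrow> rotor n X 0 = 1\<^sub>m n"
  by (intro eq_matI) (auto simp: rotor_def)

lemma rotor_mult_left:
  assumes "X \<in> carrier_mat n n" "A \<in> carrier_mat n n"
  shows "rotor n X a * A = complex_of_real (cos a) \<cdot>\<^sub>m A + (- \<i> * complex_of_real (sin a)) \<cdot>\<^sub>m (X * A)"
  using assms by (simp add: rotor_def add_mult_distrib_mat[of _ n n _ _ n] mult_smult_assoc_mat[of _ n n _ n])

lemma rotor_mult_right:
  assumes "X \<in> carrier_mat n n" "A \<in> carrier_mat n n"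
  shows "A * rotor n X a = complex_of_real (cos a) \<cdot>\<^sub>m A + (- \<i> * complex_of_real (sin a)) \<cdot>\<^sub>m (A * X)"
  using assms by (simp add: rotor_def mult_add_distrib_mat[of _ n n _ n] mult_smult_distrib[of _ n n _ n])

lemma rotor_add:
  assumes "X \<in> carrier_mat n n" "X * X = 1\<^sub>m n"
  shows "rotor n X a * rotor n X b = rotor n X (a + b)"
proof -
  have "X * rotor n X b = complex_of_real (cos b) \<cdot>\<^sub>m X + (- \<i> * complex_of_real (sin b)) \<cdot>\<^sub>m 1\<^sub>m n"
    using assms by (simp add: rotor_mult_right)
  then show ?thesis
    using assms unfolding rotor_mult_left[OF assms(1) rotor_carrier[OF assms(1)]]
    by (intro eq_matI) (auto simp: rotor_def cos_add sin_add algebra_simps)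
qed

lemma rotor_commute:
  assumes "X \<in> carrier_mat n n" "Y \<in> carrier_mat n n" "X * Y = Y * X"
  shows "rotor n X a * rotor n Y b = rotor n Y b * rotor n X a"
proof -
  have "X * rotor n Y b = rotor n Y b * X"
    using assms by (simp add: rotor_mult_left rotor_mult_right)
  then show ?thesis
    using assms by (simp add: rotor_mult_left[of X] rotor_mult_right[of X] rotor_carrier)
qed

text \<open>Moving \<open>Y\<close> past a rotation about \<open>X\<close> negates its angle. Hence
  the outer angles add in front of the identity part of the middle rotation and subtract in front of
  its \<open>Y\<close> part.\<close>

lemma rotor_triple:
  assumes X: "X \<in> carrier_mat n n" "X * X = 1\<^sub>m n" and Y: "Y \<in> carrier_mat n n"
    and anti: "Y * X = - 1 \<cdot>\<^sub>m (X * Y)"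
  shows "rotor n X a * rotor n Y b * rotor n X c =
    complex_of_real (cos b * cos (a + c)) \<cdot>\<^sub>m 1\<^sub>m n + (- \<i> * complex_of_real (cos b * sin (a + c))) \<cdot>\<^sub>m X +
    (- \<i> * complex_of_real (sin b * cos (a - c))) \<cdot>\<^sub>m Y - complex_of_real (sin b * sin (a - c)) \<cdot>\<^sub>m (X * Y)"
proof -
  note R = rotor_carrier[OF X(1)]
  have XY: "X * Y \<in> carrier_mat n n"
    using X Y by simp
  have "Y * rotor n X c = rotor n X (- c) * Y"
    unfolding rotor_mult_left[OF X(1) Y] rotor_mult_right[OF X(1) Y] anti
    using X XY by (intro eq_matI) auto
  then have "rotor n Y b * rotor n X c = complex_of_real (cos b) \<cdot>\<^sub>m rotor n X c +
      (- \<i> * complex_of_real (sin b)) \<cdot>\<^sub>m (rotor n X (- c) * Y)"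
    using R Y by (simp add: rotor_mult_left)
  then have "rotor n X a * rotor n Y b * rotor n X c =
      rotor n X a * (complex_of_real (cos b) \<cdot>\<^sub>m rotor n X c +
      (- \<i> * complex_of_real (sin b)) \<cdot>\<^sub>m (rotor n X (- c) * Y))"
    using R Y by (simp add: assoc_mult_mat[of _ n n _ n _ n] rotor_carrier)
  also have "\<dots> = complex_of_real (cos b) \<cdot>\<^sub>m (rotor n X a * rotor n X c) +
      (- \<i> * complex_of_real (sin b)) \<cdot>\<^sub>m ((rotor n X a * rotor n X (- c)) * Y)"
    using R Y mult_carrier_mat[OF R Y, of "- c"]
    by (simp add: mult_add_distrib_mat[of _ n n _ n] mult_smult_distrib[of _ n n _ n]
        assoc_mult_mat[of _ n n _ n _ n])
  also have "\<dots> = complex_of_real (cos b) \<cdot>\<^sub>m rotor n X (a + c) +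
      (- \<i> * complex_of_real (sin b)) \<cdot>\<^sub>m (rotor n X (a - c) * Y)"
    by (simp add: rotor_add[OF X])
  finally show ?thesis
    unfolding rotor_mult_left[OF X(1) Y] using X Y XY
    by (intro eq_matI) (auto simp: rotor_def algebra_simps)
qed

section \<open>Turnover by Euler angles\<close>

lemma polar_real: "\<exists>p. x = sqrt (x\<^sup>2 + y\<^sup>2) * cos p \<and> y = sqrt (x\<^sup>2 + y\<^sup>2) * sin p"
proof (cases "x\<^sup>2 + y\<^sup>2 = 0")
  case False
  define r where "r = sqrt (x\<^sup>2 + y\<^sup>2)"
  have "r \<noteq> 0" "r\<^sup>2 = x\<^sup>2 + y\<^sup>2"
    using False by (simp_all add: r_def)
  then have "(x / r)\<^sup>2 + (y / r)\<^sup>2 = 1"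
    using False by (simp add: power_divide flip: add_divide_distrib)
  then obtain p where "x / r = cos p" "y / r = sin p"
    by (rule sincos_total_2pi)
  then show ?thesis
    using \<open>r \<noteq> 0\<close> unfolding r_def[symmetric] by (metis nonzero_eq_divide_eq mult.commute)
qed simp

lemma rotor_turnover:
  assumes X: "X \<in> carrier_mat n n" "X * X = 1\<^sub>m n" and Y: "Y \<in> carrier_mat n n" "Y * Y = 1\<^sub>m n"
    and anti: "Y * X = - 1 \<cdot>\<^sub>m (X * Y)"
  shows "\<exists>a' b' c'. rotor n X a * rotor n Y b * rotor n X c = rotor n Y a' * rotor n X b' * rotor n Y c'"
proof -
  \<comment> \<open>The product is a unit quaternion with coordinates \<open>w, x, y, z\<close>; exchanging \<open>X\<close> and \<open>Y\<close> only
    exchanges \<open>x\<close> with \<open>y\<close> and negates \<open>z\<close>.\<close>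
  define w x y z where "w = cos b * cos (a + c)" "x = cos b * sin (a + c)"
    "y = sin b * cos (a - c)" "z = sin b * sin (a - c)"
  \<comment> \<open>With \<open>p = a' + c'\<close> and \<open>q = a' - c'\<close>, the product in
    the order Y, X, Y has the required coordinates once \<open>(w, y)\<close> is
    \<open>cos b'\<close> times \<open>(cos p, sin p)\<close> and \<open>(x, - z)\<close> is
    \<open>sin b'\<close> times \<open>(cos q, sin q)\<close>.\<close>
  obtain p where p: "w = sqrt (w\<^sup>2 + y\<^sup>2) * cos p" "y = sqrt (w\<^sup>2 + y\<^sup>2) * sin p"
    using polar_real by blast
  obtain q where q: "x = sqrt (x\<^sup>2 + z\<^sup>2) * cos q" "- z = sqrt (x\<^sup>2 + z\<^sup>2) * sin q"
    using polar_real[of x "- z"] by auto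
  \<comment> \<open>The coordinates have total norm 1, so the two radii are the cosine and sine of a
    common angle \<open>b'\<close>.\<close>
  have "w\<^sup>2 + x\<^sup>2 = (cos b)\<^sup>2" "y\<^sup>2 + z\<^sup>2 = (sin b)\<^sup>2"
    by (simp_all add: w_x_y_z_def power_mult_distrib flip: distrib_left)
  then have "w\<^sup>2 + y\<^sup>2 + (x\<^sup>2 + z\<^sup>2) = 1"
    using sin_cos_squared_add[of b] by linarith
  then have "(sqrt (w\<^sup>2 + y\<^sup>2))\<^sup>2 + (sqrt (x\<^sup>2 + z\<^sup>2))\<^sup>2 = 1"
    by simp
  then obtain b' where b': "sqrt (w\<^sup>2 + y\<^sup>2) = cos b'" "sqrt (x\<^sup>2 + z\<^sup>2) = sin b'"
    by (rule sincos_total_2pi)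
  have sum: "(p + q) / 2 + (p - q) / 2 = p" "(p + q) / 2 - (p - q) / 2 = q"
    by (simp_all add: field_simps)
  have XY: "X * Y = - 1 \<cdot>\<^sub>m (Y * X)" "X * Y \<in> carrier_mat n n"
    using X Y by (simp_all add: anti smult_smult_mat)
  show ?thesis
  proof (intro exI)
    show "rotor n X a * rotor n Y b * rotor n X c =
        rotor n Y ((p + q) / 2) * rotor n X b' * rotor n Y ((p - q) / 2)"
      unfolding rotor_triple[OF X Y(1) anti] rotor_triple[OF Y X(1) XY(1)] sum w_x_y_z_def[symmetric]
        p[unfolded b', symmetric] q[unfolded b', symmetric] anti
      using X Y XY(2) by (intro eq_matI) auto
  qed
qed

section \<open>Operators realised by a word of positions\<close>

text \<open>Words are read in time order, so the head letter supplies the rightmost factor.\<close>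

fun word_ops :: "nat \<Rightarrow> (nat \<Rightarrow> complex mat set) \<Rightarrow> nat list \<Rightarrow> complex mat set" where
  "word_ops n G [] = {1\<^sub>m n}"
| "word_ops n G (i # w) = {A * g | A g. A \<in> word_ops n G w \<and> g \<in> G i}"

lemma word_ops_carrier:
  assumes "\<And>i. G i \<subseteq> carrier_mat n n" "A \<in> word_ops n G w"
  shows "A \<in> carrier_mat n n"
  using assms(2)
proof (induction w arbitrary: A)
  case (Cons i w)
  then show ?case
    using assms(1)[of i] by (auto intro!: mult_carrier_mat[where n = n])
qed simp

lemma word_ops_append:
  assumes "\<And>i. G i \<subseteq> carrier_mat n n"
  shows "word_ops n G (u @ v) = {B * A | A B. A \<in> word_ops n G u \<and> B \<in> word_ops n G v}"
proof (induction u)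
  case Nil
  have "B * 1\<^sub>m n = B" if "B \<in> word_ops n G v" for B
    using word_ops_carrier[OF assms that] by simp
  then show ?case
    by (auto, metis)
next
  case (Cons i u)
  have assoc: "B * A * g = B * (A * g)"
    if "A \<in> word_ops n G u" "B \<in> word_ops n G v" "g \<in> G i" for A B g
    using word_ops_carrier[OF assms that(1)] word_ops_carrier[OF assms that(2)] assms[of i] that(3)
    by (auto intro: assoc_mult_mat[of _ n n _ n _ n])
  show ?case
    unfolding append_Cons word_ops.simps Cons
  proof safe
    fix g A B assume "g \<in> G i" "A \<in> word_ops n G u" "B \<in> word_ops n G v"
    then show "\<exists>A' B'. B * A * g = B' * A' \<and>
        A' \<in> {A * g |A g. A \<in> word_ops n G u \<and> g \<in> G i} \<and> B' \<in> word_ops n G v"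
      using assoc by blast
  next
    fix g A B assume "g \<in> G i" "A \<in> word_ops n G u" "B \<in> word_ops n G v"
    then show "\<exists>A' g'. B * (A * g) = A' * g' \<and>
        A' \<in> {B * A |A B. A \<in> word_ops n G u \<and> B \<in> word_ops n G v} \<and> g' \<in> G i"
      using assoc[symmetric] by blast
  qed
qed

lemma word_ops_positions:
  assumes "A \<in> word_ops n G w" "i \<in> set w"
  shows "G i \<noteq> {}"
  using assms by (induction w arbitrary: A) auto

text \<open>What turns each Hecke relation into an equality of sets of operators: \<open>one\<close>
  and \<open>mult\<close> give the two inclusions for fusion, \<open>turnover\<close> and
  \<open>turnover'\<close> those for the braid relation. Positions outside a finite chain carry the
  empty set, hence the condition in \<open>one\<close>.\<close>

locale gate_family =
  fixes n :: nat and G :: "nat \<Rightarrow> complex mat set"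
  assumes carrier: "G i \<subseteq> carrier_mat n n"
    and one: "G i \<noteq> {} \<Longrightarrow> 1\<^sub>m n \<in> G i"
    and mult: "x \<in> G i \<Longrightarrow> y \<in> G i \<Longrightarrow> x * y \<in> G i"
    and commute: "i + 1 < j \<Longrightarrow> x \<in> G i \<Longrightarrow> y \<in> G j \<Longrightarrow> x * y = y * x"
    and turnover: "x \<in> G i \<Longrightarrow> y \<in> G (i + 1) \<Longrightarrow> z \<in> G i \<Longrightarrow>
      \<exists>x'\<in>G (i + 1). \<exists>y'\<in>G i. \<exists>z'\<in>G (i + 1). x * y * z = x' * y' * z'"
    and turnover': "x \<in> G (i + 1) \<Longrightarrow> y \<in> G i \<Longrightarrow> z \<in> G (i + 1) \<Longrightarrow>
      \<exists>x'\<in>G i. \<exists>y'\<in>G (i + 1). \<exists>z'\<in>G i. x * y * z = x' * y' * z'"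
begin

lemma gate_carrier: "x \<in> G i \<Longrightarrow> x \<in> carrier_mat n n"
  using carrier by blast

lemma word_ops_1: "word_ops n G [i] = G i"
proof -
  have "1\<^sub>m n * x = x" if "x \<in> G i" for x
    using gate_carrier[OF that] by simp
  then show ?thesis
    by (auto, metis)
qed

lemma word_ops_2: "word_ops n G [i, j] = {y * x | x y. x \<in> G i \<and> y \<in> G j}"
  using word_ops_append[of G n "[i]" "[j]"] carrier by (simp add: word_ops_1 del: word_ops.simps)

lemma word_ops_3: "word_ops n G [i, j, k] = {z * y * x | x y z. x \<in> G i \<and> y \<in> G j \<and> z \<in> G k}"
  by (subst word_ops.simps, unfold word_ops_2) auto

lemma word_ops_hecke:
  assumes "u \<approx> v"
  shows "word_ops n G u = word_ops n G v"
  using assms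
proof induction
  case (append u u' v v')
  then show ?case
    using carrier by (simp add: word_ops_append)
next
  case (idem i)
  have "\<exists>g h. x = h * g \<and> g \<in> G i \<and> h \<in> G i" if "x \<in> G i" for x
    using one[of i] gate_carrier that by (metis empty_iff left_mult_one_mat)
  then show ?case
    using mult unfolding word_ops_1 word_ops_2 by blast
next
  case (comm i j)
  then show ?case
    unfolding word_ops_2 using commute[OF comm] by (safe; metis)
next
  case (braid i)
  show ?case
    unfolding word_ops_3
  proof safe
    fix x y z assume "x \<in> G i" "y \<in> G (i + 1)" "z \<in> G i"
    then show "\<exists>x' y' z'. z * y * x = z' * y' * x' \<and> x' \<in> G (i + 1) \<and> y' \<in> G i \<and> z' \<in> G (i + 1)"
      using turnover[of z i y x] by blast
  next
    fix x y z assume "x \<in> G (i + 1)" "y \<in> G i" "z \<in> G (i + 1)"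
    then show "\<exists>x' y' z'. z * y * x = z' * y' * x' \<and> x' \<in> G i \<and> y' \<in> G (i + 1) \<and> z' \<in> G i"
      using turnover'[of z i y x] by blast
  qed
qed auto

lemma one_in_word_ops:
  assumes "\<forall>i\<in>set w. G i \<noteq> {}"
  shows "1\<^sub>m n \<in> word_ops n G w"
  using assms
proof (induction w)
  case (Cons i w)
  moreover have "1\<^sub>m n * 1\<^sub>m n = (1\<^sub>m n :: complex mat)"
    by simp
  ultimately show ?case
    using one[of i] by (metis (mono_tags, lifting) list.set_intros mem_Collect_eq word_ops.simps(2))
qed simp

text \<open>A triangle of identity gates put in front of \<open>w\<close> in time leaves
  \<open>A\<close> unchanged; the triangle word then absorbs \<open>w\<close>.\<close>

lemma compress_triangle:
  assumes "A \<in> word_ops n G w" "set w \<subseteq> {l..<m}" "\<And>i. l \<le> i \<Longrightarrow> i < m \<Longrightarrow> G i \<noteq> {}"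
  shows "A \<in> word_ops n G (triangle_word l m)"
proof -
  have "1\<^sub>m n \<in> word_ops n G (triangle_word l m)"
    using assms(3) by (intro one_in_word_ops) (auto simp: triangle_word_def)
  moreover have "A * 1\<^sub>m n = A"
    using word_ops_carrier[OF carrier assms(1)] by simp
  ultimately have "A \<in> word_ops n G (triangle_word l m @ w)"
    unfolding word_ops_append[OF carrier] mem_Collect_eq using assms(1) by metis
  then show ?thesis
    using word_ops_hecke[OF triangle_word_absorb_word[OF assms(2)]] by simp
qed

end

section \<open>Time-ordered products and circuits as words\<close>

lemma fold_mat_mult_carrier:
  fixes A :: "complex mat"
  assumes "set gs \<subseteq> carrier_mat n n" "A \<in> carrier_mat n n"
  shows "fold (*) gs A \<in> carrier_mat n n"
  using assms by (induction gs arbitrary: A) (auto intro!: mult_carrier_mat[where n = n])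

lemma fold_mat_mult:
  fixes A :: "complex mat"
  assumes "set gs \<subseteq> carrier_mat n n" "A \<in> carrier_mat n n"
  shows "fold (*) gs A = fold (*) gs (1\<^sub>m n) * A"
  using assms
proof (induction gs arbitrary: A)
  case (Cons h gs)
  let ?F = "fold (*) gs (1\<^sub>m n)"
  have gs: "set gs \<subseteq> carrier_mat n n" "h \<in> carrier_mat n n"
    using Cons.prems(1) by auto
  then have F: "?F \<in> carrier_mat n n"
    by (intro fold_mat_mult_carrier) auto
  have "fold (*) (h # gs) A = ?F * (h * A)"
    using Cons.IH[OF gs(1), of "h * A"] gs(2) Cons.prems(2) by simp
  also have "\<dots> = ?F * h * A"
    using F gs(2) Cons.prems(2) by (rule assoc_mult_mat[symmetric])
  also have "?F * h = fold (*) (h # gs) (1\<^sub>m n)"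
    using Cons.IH[OF gs] gs(2) by simp
  finally show ?case .
qed simp

lemma time_ordered_prod_Cons:
  assumes "g \<in> carrier_mat (2 ^ N) (2 ^ N)" "set gs \<subseteq> carrier_mat (2 ^ N) (2 ^ N)"
  shows "time_ordered_prod N (g # gs) = time_ordered_prod N gs * g"
  using fold_mat_mult[OF assms(2,1)] assms(1) by (simp add: time_ordered_prod_def)

lemma word_ops_circuit:
  assumes "\<And>i. G i \<subseteq> carrier_mat (2 ^ N) (2 ^ N)" "A \<in> word_ops (2 ^ N) G w"
  shows "\<exists>c. map fst c = w \<and> (\<forall>(i, g)\<in>set c. g \<in> G i) \<and> A = circuit_op N c"
  using assms(2)
proof (induction w arbitrary: A)
  case Nil
  then show ?case
    by (simp add: circuit_op_def time_ordered_prod_def)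
next
  case (Cons i w)
  then obtain B g where B: "B \<in> word_ops (2 ^ N) G w" "g \<in> G i" "A = B * g"
    by auto
  obtain c where c: "map fst c = w" "\<forall>(i, g)\<in>set c. g \<in> G i" "B = circuit_op N c"
    using Cons.IH[OF B(1)] by blast
  have "set (map snd c) \<subseteq> carrier_mat (2 ^ N) (2 ^ N)" "g \<in> carrier_mat (2 ^ N) (2 ^ N)"
    using c(2) B(2) assms(1) by fastforce+
  then have "circuit_op N ((i, g) # c) = A"
    by (simp add: circuit_op_def time_ordered_prod_Cons B(3) c(3))
  then show ?case
    using c B(2) by (intro exI[of _ "(i, g) # c"]) auto
qed

lemma time_ordered_prod_word_ops:
  assumes "\<And>i. G i \<subseteq> carrier_mat (2 ^ N) (2 ^ N)" "\<forall>g\<in>set gs. \<exists>w. g \<in> word_ops (2 ^ N) G w"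
  shows "\<exists>w. time_ordered_prod N gs \<in> word_ops (2 ^ N) G w"
  using assms(2)
proof (induction gs)
  case Nil
  have "time_ordered_prod N [] \<in> word_ops (2 ^ N) G []"
    by (simp add: time_ordered_prod_def)
  then show ?case ..
next
  case (Cons g gs)
  then obtain u v where "g \<in> word_ops (2 ^ N) G u" "time_ordered_prod N gs \<in> word_ops (2 ^ N) G v"
    by auto
  moreover have "time_ordered_prod N (g # gs) = time_ordered_prod N gs * g"
    using Cons.prems word_ops_carrier[OF assms(1)] by (intro time_ordered_prod_Cons) auto
  ultimately have "time_ordered_prod N (g # gs) \<in> word_ops (2 ^ N) G (u @ v)"
    unfolding word_ops_append[OF assms(1)] by auto
  then show ?case ..
qed

section \<open>The two commuting chains\<close>

definition chain_gates :: "nat \<Rightarrow> pauli \<Rightarrow> pauli \<Rightarrow> nat \<Rightarrow> complex mat set" where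
  "chain_gates N a b i =
    (if 1 \<le> i \<and> i < N then range (rot N (if odd i then a else b) i) else {})"

lemma chain_gates_rotor:
  assumes "x \<in> chain_gates N a b i"
  obtains \<theta> where "1 \<le> i" "i < N" "x = rotor (2 ^ N) (bond N (if odd i then a else b) i) \<theta>"
proof -
  have i: "1 \<le> i" "i < N"
    using assms by (auto simp: chain_gates_def split: if_splits)
  then obtain \<phi> where "x = rot N (if odd i then a else b) i \<phi>"
    using assms unfolding chain_gates_def by auto
  then show thesis
    using that i rot_eq_rotor[OF i] by blast
qed

lemma rotor_in_chain_gates:
  assumes "1 \<le> i" "i < N"
  shows "rotor (2 ^ N) (bond N (if odd i then a else b) i) \<theta> \<in> chain_gates N a b i"
proof -
  have "rotor (2 ^ N) (bond N c i) \<theta> = rot N c i (2 * \<theta>)" for c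
    by (simp add: rot_eq_rotor[OF assms])
  then show ?thesis
    using assms by (simp add: chain_gates_def)
qed

lemma chain_gates_carrier: "chain_gates N a b i \<subseteq> carrier_mat (2 ^ N) (2 ^ N)"
  by (auto elim!: chain_gates_rotor intro!: rotor_carrier bond_carrier)

lemma word_ops_chain_gates_carrier:
  "A \<in> word_ops (2 ^ N) (chain_gates N a b) w \<Longrightarrow> A \<in> carrier_mat (2 ^ N) (2 ^ N)"
  by (rule word_ops_carrier[where G = "chain_gates N a b"]) (rule chain_gates_carrier)

lemma gate_family_chain_gates:
  assumes "a \<noteq> b"
  shows "gate_family (2 ^ N) (chain_gates N a b)"
proof -
  define X where "X i = bond N (if odd i then a else b) i" for i
  have X: "X i \<in> carrier_mat (2 ^ N) (2 ^ N)" "X i * X i = 1\<^sub>m (2 ^ N)" if "1 \<le> i" "i < N" for i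
    using that bond_carrier bond_square by (simp_all add: X_def)
  \<comment> \<open>Neighbouring bonds of one chain have different types and share exactly one
    spin.\<close>
  have anti: "X (i + 1) * X i = - 1 \<cdot>\<^sub>m (X i * X (i + 1))" "X i * X (i + 1) = - 1 \<cdot>\<^sub>m (X (i + 1) * X i)"
    if "1 \<le> i" "i + 1 < N" for i
    using that assms swaps_bond[of "i + 1" N i] swaps_bond[of i N "i + 1"]
    by (auto simp: X_def swaps_def spin_sign_def)
  have chain: "\<exists>\<theta>. x = rotor (2 ^ N) (X i) \<theta>" "1 \<le> i" "i < N" if "x \<in> chain_gates N a b i" for x i
    using that chain_gates_rotor unfolding X_def by metis+
  have in_chain: "rotor (2 ^ N) (X i) \<theta> \<in> chain_gates N a b i" if "1 \<le> i" "i < N" for i \<theta>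
    unfolding X_def using that by (rule rotor_in_chain_gates)
  show ?thesis
  proof
    show "chain_gates N a b i \<subseteq> carrier_mat (2 ^ N) (2 ^ N)" for i
      by (rule chain_gates_carrier)
    show "1\<^sub>m (2 ^ N) \<in> chain_gates N a b i" if "chain_gates N a b i \<noteq> {}" for i
    proof -
      have "1 \<le> i" "i < N"
        using that chain by auto
      then show ?thesis
        using in_chain[of i 0] by (simp add: rotor_0[OF X(1)])
    qed
    show "x * y \<in> chain_gates N a b i" if xyz: "x \<in> chain_gates N a b i" "y \<in> chain_gates N a b i" for x y i
    proof -
      obtain \<theta> \<phi> where "x = rotor (2 ^ N) (X i) \<theta>" "y = rotor (2 ^ N) (X i) \<phi>"
        using xyz(1,2)[THEN chain(1)] by blast
      then show ?thesis
        using chain(2,3)[OF xyz(1)] by (simp add: rotor_add[OF X] in_chain)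
    qed
    show "x * y = y * x" if xyz: "i + 1 < j" "x \<in> chain_gates N a b i" "y \<in> chain_gates N a b j" for x y i j
    proof -
      obtain \<theta> \<phi> where "x = rotor (2 ^ N) (X i) \<theta>" "y = rotor (2 ^ N) (X j) \<phi>"
        using xyz(2,3)[THEN chain(1)] by blast
      moreover have "X i * X j = X j * X i"
        using xyz(1) chain(2,3)[OF xyz(2)] chain(2,3)[OF xyz(3)] swaps_bond[of i N j]
        by (auto simp: X_def swaps_def spin_sign_def)
      ultimately show ?thesis
        using chain(2,3)[OF xyz(2)] chain(2,3)[OF xyz(3)] by (simp add: rotor_commute[OF X(1) X(1)])
    qed
    show "\<exists>x'\<in>chain_gates N a b (i + 1). \<exists>y'\<in>chain_gates N a b i. \<exists>z'\<in>chain_gates N a b (i + 1).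
        x * y * z = x' * y' * z'"
      if xyz: "x \<in> chain_gates N a b i" "y \<in> chain_gates N a b (i + 1)" "z \<in> chain_gates N a b i" for x y z i
    proof -
      obtain \<theta> \<phi> \<psi> where "x = rotor (2 ^ N) (X i) \<theta>" "y = rotor (2 ^ N) (X (i + 1)) \<phi>"
        "z = rotor (2 ^ N) (X i) \<psi>"
        using xyz(1-3)[THEN chain(1)] by blast
      moreover have i: "1 \<le> i" "i < N" "1 \<le> i + 1" "i + 1 < N"
        using chain(2,3)[OF xyz(1)] chain(2,3)[OF xyz(2)] by auto
      ultimately show ?thesis
        using rotor_turnover[OF X[OF i(1,2)] X[OF i(3,4)] anti(1)[OF i(1,4)], of \<theta> \<phi> \<psi>] in_chain
        by metis
    qed
    show "\<exists>x'\<in>chain_gates N a b i. \<exists>y'\<in>chain_gates N a b (i + 1). \<exists>z'\<in>chain_gates N a b i.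
        x * y * z = x' * y' * z'"
      if xyz: "x \<in> chain_gates N a b (i + 1)" "y \<in> chain_gates N a b i" "z \<in> chain_gates N a b (i + 1)" for x y z i
    proof -
      obtain \<theta> \<phi> \<psi> where "x = rotor (2 ^ N) (X (i + 1)) \<theta>" "y = rotor (2 ^ N) (X i) \<phi>"
        "z = rotor (2 ^ N) (X (i + 1)) \<psi>"
        using xyz(1-3)[THEN chain(1)] by blast
      moreover have i: "1 \<le> i" "i < N" "1 \<le> i + 1" "i + 1 < N"
        using chain(2,3)[OF xyz(1)] chain(2,3)[OF xyz(2)] by auto
      ultimately show ?thesis
        using rotor_turnover[OF X[OF i(3,4)] X[OF i(1,2)] anti(2)[OF i(1,4)], of \<theta> \<phi> \<psi>] in_chain
        by metis
    qed
  qed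
qed

text \<open>At positions of different parity the two bonds have the same type. At positions of equal
  parity the types differ, but the bonds share both spins or none, so the signs cancel.\<close>

lemma chain_gates_commute:
  assumes "a \<noteq> b" "x \<in> chain_gates N a b i" "y \<in> chain_gates N b a j"
  shows "x * y = y * x"
proof -
  let ?X = "bond N (if odd i then a else b) i" and ?Y = "bond N (if odd j then b else a) j"
  obtain \<theta> \<phi> where i: "1 \<le> i" "i < N" "x = rotor (2 ^ N) ?X \<theta>"
    and j: "1 \<le> j" "j < N" "y = rotor (2 ^ N) ?Y \<phi>"
    using assms(2,3) chain_gates_rotor by metis
  have "?X * ?Y = ?Y * ?X"
    using swaps_bond[OF i(1,2) j(1,2)] assms(1)
    by (auto simp: swaps_def spin_sign_def split: if_splits)
  then show ?thesis
    unfolding i j using i(1,2) j(1,2) by (intro rotor_commute bond_carrier)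
qed

definition rot2_gates :: "nat \<Rightarrow> pauli \<Rightarrow> pauli \<Rightarrow> nat \<Rightarrow> complex mat set" where
  "rot2_gates N a b i = (if 1 \<le> i \<and> i < N then {rot2 N a b i \<theta> \<theta>' | \<theta> \<theta>'. True} else {})"

lemma rot2_gates_eq:
  assumes "a \<noteq> b"
  shows "rot2_gates N a b i = {x * y | x y. x \<in> chain_gates N a b i \<and> y \<in> chain_gates N b a i}"
proof (cases "1 \<le> i \<and> i < N")
  case True
  show ?thesis
  proof (cases "odd i")
    case odd: True
    show ?thesis
      using True odd by (auto simp: rot2_gates_def chain_gates_def rot2_def)
  next
    case False
    \<comment> \<open>At even positions the first chain carries the type \<open>b\<close>, so the
      factors of \<open>rot2\<close> occur in the opposite order.\<close>
    have "rot N b i \<theta>' * rot N a i \<theta> = rot N a i \<theta> * rot N b i \<theta>'" for \<theta> \<theta>'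
      using True False by (intro chain_gates_commute[OF assms]) (auto simp: chain_gates_def)
    then show ?thesis
      using True False by (auto simp: rot2_gates_def chain_gates_def rot2_def) (metis rangeI)
  qed
qed (auto simp: rot2_gates_def chain_gates_def)

lemma rot2_gates_carrier: "a \<noteq> b \<Longrightarrow> rot2_gates N a b i \<subseteq> carrier_mat (2 ^ N) (2 ^ N)"
  using chain_gates_carrier
  by (fastforce simp: rot2_gates_eq intro!: mult_carrier_mat[where n = "2 ^ N"])

text \<open>Every gate is a product of one gate from each chain, and the chains commute, so the
  factors of the first chain can be collected on the left. Both sides use the same word
  \<open>w\<close>; read backwards, two circuits over one word therefore merge gate by gate.\<close>

lemma word_ops_rot2_gates:
  assumes "a \<noteq> b"
  shows "word_ops (2 ^ N) (rot2_gates N a b) w =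
    {A * B | A B. A \<in> word_ops (2 ^ N) (chain_gates N a b) w \<and> B \<in> word_ops (2 ^ N) (chain_gates N b a) w}"
proof (induction w)
  case (Cons i w)
  let ?P = "chain_gates N a b" and ?Q = "chain_gates N b a"
  have swap: "B * x = x * B" if "x \<in> ?P i" "B \<in> word_ops (2 ^ N) ?Q w" for x B
    using that(2)
  proof (induction w arbitrary: B)
    case Nil
    then show ?case
      using that(1) chain_gates_carrier by fastforce
  next
    case (Cons j w)
    then obtain C y where C: "C \<in> word_ops (2 ^ N) ?Q w" "y \<in> ?Q j" "B = C * y"
      by auto
    note c = subsetD[OF chain_gates_carrier that(1)] subsetD[OF chain_gates_carrier C(2)]
      word_ops_chain_gates_carrier[OF C(1)]
    note assoc = assoc_mult_mat[of _ "2 ^ N" "2 ^ N" _ "2 ^ N" _ "2 ^ N"]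
    have "B * x = C * (y * x)"
      unfolding C(3) using c by (intro assoc)
    also have "y * x = x * y"
      by (rule chain_gates_commute[OF assms that(1) C(2), symmetric])
    also have "C * (x * y) = C * x * y"
      using c by (intro assoc[symmetric])
    also have "C * x = x * C"
      by (rule Cons.IH[OF C(1)])
    also have "x * C * y = x * B"
      unfolding C(3) using c by (intro assoc)
    finally show ?case .
  qed
  have split: "A * B * (x * y) = (A * x) * (B * y)"
    if "A \<in> word_ops (2 ^ N) ?P w" "B \<in> word_ops (2 ^ N) ?Q w" "x \<in> ?P i" "y \<in> ?Q i" for A B x y
  proof -
    note c = that(1,2)[THEN word_ops_chain_gates_carrier] that(3,4)[THEN subsetD[OF chain_gates_carrier]]
    note assoc = assoc_mult_mat[of _ "2 ^ N" "2 ^ N" _ "2 ^ N" _ "2 ^ N"]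
    have "A * B * (x * y) = A * (B * x) * y"
      using c by (simp add: assoc)
    also have "B * x = x * B"
      by (rule swap[OF that(3,2)])
    also have "A * (x * B) * y = (A * x) * (B * y)"
      using c by (simp add: assoc)
    finally show ?thesis .
  qed
  show ?case (is "?L = ?R")
  proof (intro subset_antisym subsetI)
    fix z assume "z \<in> ?L"
    then obtain A B x y where
      "A \<in> word_ops (2 ^ N) ?P w" "B \<in> word_ops (2 ^ N) ?Q w" "x \<in> ?P i" "y \<in> ?Q i"
      "z = A * B * (x * y)"
      unfolding word_ops.simps Cons rot2_gates_eq[OF assms, of N i] by blast
    then show "z \<in> ?R"
      unfolding word_ops.simps mem_Collect_eq using split by metis
  next
    fix z assume "z \<in> ?R"
    then obtain A B x y where
      "A \<in> word_ops (2 ^ N) ?P w" "B \<in> word_ops (2 ^ N) ?Q w" "x \<in> ?P i" "y \<in> ?Q i"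
      "z = A * x * (B * y)"
      unfolding word_ops.simps by blast
    then show "z \<in> ?L"
      unfolding word_ops.simps Cons rot2_gates_eq[OF assms, of N i] mem_Collect_eq using split by metis
  qed
qed simp

section \<open>Depth and layers of circuits\<close>

lemma depth_concat_le:
  assumes "\<And>L p q. L \<in> set Ls \<Longrightarrow> p < q \<Longrightarrow> q < length L \<Longrightarrow>
    {fst (L ! p), fst (L ! p) + 1} \<inter> {fst (L ! q), fst (L ! q) + 1} = {}"
  shows "depth (concat Ls) \<le> length Ls"
  unfolding depth_def
proof (rule Least_le, use assms in \<open>induction Ls\<close>)
  case (Cons L Ls)
  then obtain step where step: "\<forall>p < length (concat Ls). step p < length Ls"
    "\<And>p q. p < q \<Longrightarrow> q < length (concat Ls) \<Longrightarrow>
      {fst (concat Ls ! p), fst (concat Ls ! p) + 1} \<inter> {fst (concat Ls ! q), fst (concat Ls ! q) + 1} \<noteq> {}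
      \<Longrightarrow> step p < step q"
    by (metis (no_types, lifting) list.set_intros(2))
  \<comment> \<open>Each block takes one time step: the first block runs at step 0 and the schedule
    of the others is delayed by one.\<close>
  define step' where "step' p = (if p < length L then 0 else Suc (step (p - length L)))" for p
  have "step' p < length (L # Ls)" if "p < length (concat (L # Ls))" for p
    using that step(1) by (auto simp: step'_def)
  moreover have "step' p < step' q"
    if pq: "p < q" "q < length (concat (L # Ls))"
      and meet: "{fst (concat (L # Ls) ! p), fst (concat (L # Ls) ! p) + 1} \<inter>
        {fst (concat (L # Ls) ! q), fst (concat (L # Ls) ! q) + 1} \<noteq> {}" for p q
  proof (cases "q < length L")
    case True
    then show ?thesis
      using Cons.prems[of L p q] pq(1) meet by (simp add: nth_append)
  next
    case False
    then show ?thesis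
      using step(2)[of "p - length L" "q - length L"] pq meet
      by (cases "p < length L") (simp_all add: step'_def nth_append diff_less_mono)
  qed
  ultimately show ?case
    by blast
qed simp

text \<open>Distinct positions of equal parity differ by at least two.\<close>

lemma layer_gates_disjoint:
  assumes "is_odd_layer N L \<or> is_even_layer N L" "p < q" "q < length L"
  shows "{fst (L ! p), fst (L ! p) + 1} \<inter> {fst (L ! q), fst (L ! q) + 1} = {}"
proof -
  have "fst (L ! p) \<noteq> fst (L ! q)"
    using assms nth_eq_iff_index_eq[of "map fst L" p q] by (auto simp: is_odd_layer_def is_even_layer_def)
  moreover have "fst (L ! p) \<in> fst ` set L" "fst (L ! q) \<in> fst ` set L"
    using assms(2,3) by auto
  then have "even (fst (L ! p)) \<longleftrightarrow> even (fst (L ! q))"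
    using assms(1) by (auto simp: is_odd_layer_def is_even_layer_def)
  ultimately show ?thesis
    by (auto; metis even_Suc)
qed

lemma depth_square_circuit:
  assumes "is_square_circuit N c"
  shows "depth c \<le> N"
proof -
  obtain Ls where Ls: "c = concat Ls" "length Ls = N"
    "\<forall>k<N. if even k then is_odd_layer N (Ls ! k) else is_even_layer N (Ls ! k)"
    using assms unfolding is_square_circuit_def by blast
  have "is_odd_layer N L \<or> is_even_layer N L" if "L \<in> set Ls" for L
    using that Ls(2,3) by (metis in_set_conv_nth)
  then show ?thesis
    using depth_concat_le[of Ls] layer_gates_disjoint Ls(1,2) by blast
qed

text \<open>Recovers the layers of a circuit of which only the concatenated list of positions is
  known.\<close>

lemma map_eq_concat:
  assumes "map f xs = concat yss"
  shows "\<exists>xss. xs = concat xss \<and> map (map f) xss = yss"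
  using assms
proof (induction yss arbitrary: xs)
  case (Cons ys yss)
  then obtain us vs where "xs = us @ vs" "map f us = ys" "map f vs = concat yss"
    by (auto simp: map_eq_append_conv)
  moreover from Cons.IH[OF this(3)] obtain xss where "vs = concat xss" "map (map f) xss = yss"
    by blast
  ultimately show ?case
    by (intro exI[of _ "us # xss"]) simp
qed simp

lemma is_triangle_circuit_iff: "1 \<le> N \<Longrightarrow> is_triangle_circuit N c \<longleftrightarrow> map fst c = triangle_word 1 N"
  by (simp add: is_triangle_circuit_def triangle_word_def)

text \<open>With \<open>p = 1\<close>, layer \<open>k\<close> has positions of the parity of
  \<open>k + 1\<close>, odd exactly for even \<open>k\<close>.\<close>

lemma is_square_circuit_brick:
  assumes "map fst c = map fst (brick_events 1 N 1 N)"
  shows "is_square_circuit N c"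
proof -
  obtain Ls where Ls: "c = concat Ls" "map (map fst) Ls = map (\<lambda>t. layer_word 1 N (t + 1)) [0..<N]"
    using assms map_eq_concat unfolding fst_brick_events by metis
  have len: "length Ls = N"
    using Ls(2) by (metis length_map length_upt diff_zero)
  have "map fst (Ls ! k) = layer_word 1 N (k + 1)" if "k < N" for k
    using arg_cong[OF Ls(2), of "\<lambda>xs. xs ! k"] that len by simp
  moreover from this have "fst ` set (Ls ! k) = set (layer_word 1 N (k + 1))" if "k < N" for k
    using that by (metis set_map)
  ultimately show ?thesis
    unfolding is_square_circuit_def using Ls(1) len
    by (intro exI[of _ Ls]) (auto simp: is_odd_layer_def is_even_layer_def layer_word_def)
qed

section \<open>Compression of the Trotter circuit\<close>

lemma trotter_evolution_word_ops:
  assumes "a \<noteq> b"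
  shows "\<exists>w. trotter_evolution N a b J t0 \<Delta>t n \<in> word_ops (2 ^ N) (rot2_gates N a b) w"
proof -
  let ?ops = "word_ops (2 ^ N) (rot2_gates N a b)"
  note carrier = rot2_gates_carrier[OF assms]
  have gate: "\<exists>w. rot2 N a b i \<theta> \<theta>' \<in> ?ops w" if "i \<in> {1..<N}" for i \<theta> \<theta>'
  proof -
    have "rot2 N a b i \<theta> \<theta>' \<in> rot2_gates N a b i"
      using that by (auto simp: rot2_gates_def)
    moreover from this have "1\<^sub>m (2 ^ N) * rot2 N a b i \<theta> \<theta>' = rot2 N a b i \<theta> \<theta>'"
      using carrier by (meson left_mult_one_mat subsetD)
    ultimately have "rot2 N a b i \<theta> \<theta>' \<in> ?ops [i]"
      unfolding word_ops.simps mem_Collect_eq by (metis singletonI)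
    then show ?thesis ..
  qed
  have "\<exists>w. trotter_step N a b J \<Delta>t t \<in> ?ops w" for t
  proof -
    have "\<exists>w. time_ordered_prod N
        (map (\<lambda>i. rot2 N a b i (2 * J a i t * \<Delta>t) (2 * J b i t * \<Delta>t)) (filter P [1..<N])) \<in> ?ops w" for P
      by (rule time_ordered_prod_word_ops[OF carrier]) (use gate in auto)
    then obtain u v where "time_ordered_prod N
        (map (\<lambda>i. rot2 N a b i (2 * J a i t * \<Delta>t) (2 * J b i t * \<Delta>t)) (filter odd [1..<N])) \<in> ?ops u"
      "time_ordered_prod N
        (map (\<lambda>i. rot2 N a b i (2 * J a i t * \<Delta>t) (2 * J b i t * \<Delta>t)) (filter even [1..<N])) \<in> ?ops v"
      by meson
    then have "trotter_step N a b J \<Delta>t t \<in> ?ops (u @ v)"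
      unfolding trotter_step_def word_ops_append[OF carrier] by blast
    then show ?thesis ..
  qed
  then show ?thesis
    unfolding trotter_evolution_def by (intro time_ordered_prod_word_ops[OF carrier]) auto
qed

theorem mainTheorem4:
  "\<exists>d :: nat \<Rightarrow> nat. (\<lambda>N. real (d N)) \<in> O(\<lambda>N. real N) \<and>
    (\<forall>(N :: nat) (\<alpha> :: pauli) (\<beta> :: pauli) (J :: pauli \<Rightarrow> nat \<Rightarrow> real \<Rightarrow> real)
       (H :: real \<Rightarrow> complex mat) (t0 :: real) (\<Delta>t :: real) (n :: nat) (U :: complex mat).
      N \<ge> 2 \<longrightarrow> \<alpha> \<noteq> \<beta> \<longrightarrow>
      (\<forall>t. H t = hamiltonian N \<alpha> \<beta> J t) \<longrightarrow>
      (\<forall>i\<in>{1..N - 1}. \<forall>t. J \<alpha> i t \<noteq> 0 \<and> J \<beta> i t \<noteq> 0) \<longrightarrow>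
      \<Delta>t > 0 \<longrightarrow> real n > real N / 2 \<longrightarrow>
      U = trotter_evolution N \<alpha> \<beta> J t0 \<Delta>t n \<longrightarrow>
      (\<exists>A B. is_triangle_circuit N A \<and> is_triangle_circuit N B \<and>
         (\<forall>(i, g)\<in>set A. (odd i \<longrightarrow> (\<exists>\<theta>. g = rot N \<alpha> i \<theta>)) \<and> (even i \<longrightarrow> (\<exists>\<theta>. g = rot N \<beta> i \<theta>))) \<and>
         (\<forall>(i, g)\<in>set B. (odd i \<longrightarrow> (\<exists>\<theta>. g = rot N \<beta> i \<theta>)) \<and> (even i \<longrightarrow> (\<exists>\<theta>. g = rot N \<alpha> i \<theta>))) \<and>
         U = circuit_op N A * circuit_op N B) \<and>
      (\<exists>C. is_triangle_circuit N C \<and>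
         (\<forall>(i, g)\<in>set C. \<exists>\<theta> \<theta>'. g = rot2 N \<alpha> \<beta> i \<theta> \<theta>') \<and> U = circuit_op N C) \<and>
      (\<exists>C. is_square_circuit N C \<and>
         (\<forall>(i, g)\<in>set C. \<exists>\<theta> \<theta>'. g = rot2 N \<alpha> \<beta> i \<theta> \<theta>') \<and> U = circuit_op N C) \<and>
      (\<exists>C. is_circuit N C \<and>
         (\<forall>(i, g)\<in>set C. \<exists>\<theta> \<theta>'. g = rot2 N \<alpha> \<beta> i \<theta> \<theta>') \<and> U = circuit_op N C \<and>
         depth C \<le> d N))"
\<comment> \<open>The depth bound \<open>N\<close> comes from the \<open>N\<close> layers of the
  square circuit.\<close>
proof (rule exI[of _ "\<lambda>N. N"], rule conjI[OF landau_o.big_refl], intro allI impI)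
  fix N n :: nat and \<alpha> \<beta> :: pauli and J H and t0 \<Delta>t :: real and U
  assume N: "N \<ge> 2" and neq: "\<alpha> \<noteq> \<beta>" and U: "U = trotter_evolution N \<alpha> \<beta> J t0 \<Delta>t n"
  let ?T = "triangle_word 1 N" and ?S = "map fst (brick_events 1 N 1 N)"
  let ?P = "chain_gates N \<alpha> \<beta>" and ?Q = "chain_gates N \<beta> \<alpha>" and ?R = "rot2_gates N \<alpha> \<beta>"
  interpret P: gate_family "2 ^ N" ?P
    by (rule gate_family_chain_gates[OF neq])
  interpret Q: gate_family "2 ^ N" ?Q
    by (rule gate_family_chain_gates[OF neq[symmetric]])
  obtain w where w: "U \<in> word_ops (2 ^ N) ?R w"
    unfolding U using trotter_evolution_word_ops[OF neq] by blast
  \<comment> \<open>Outside the chain the gate sets are empty, so a word that realises an operator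
    only uses admissible positions.\<close>
  have "set w \<subseteq> {1..<N}"
    using word_ops_positions[OF w] by (fastforce simp: rot2_gates_def split: if_splits)
  moreover obtain A B where AB: "U = A * B" "A \<in> word_ops (2 ^ N) ?P w" "B \<in> word_ops (2 ^ N) ?Q w"
    using w unfolding word_ops_rot2_gates[OF neq] by blast
  ultimately have tri: "A \<in> word_ops (2 ^ N) ?P ?T" "B \<in> word_ops (2 ^ N) ?Q ?T"
    by (auto simp: chain_gates_def intro: P.compress_triangle Q.compress_triangle)
  \<comment> \<open>Both chains are compressed to the same triangle word, so their gates merge into
    \<open>rot2\<close> gates of a single triangle.\<close>
  then have R_tri: "U \<in> word_ops (2 ^ N) ?R ?T"
    unfolding word_ops_rot2_gates[OF neq] AB(1) by blast
  have "?S \<approx> ?T"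
    using brick_word_triangle_word[of 1 N 1] N by simp
  \<comment> \<open>Each chain is invariant under Hecke equivalence separately; the splitting of
    \<open>rot2\<close> words transfers this to the merged circuit.\<close>
  then have R_square: "U \<in> word_ops (2 ^ N) ?R ?S"
    using R_tri unfolding word_ops_rot2_gates[OF neq] by (simp add: P.word_ops_hecke Q.word_ops_hecke)
  have gate: "1 \<le> i \<and> i < N \<and> (\<exists>\<theta> \<theta>'. g = rot2 N \<alpha> \<beta> i \<theta> \<theta>')" if "g \<in> ?R i" for i g
    using that by (auto simp: rot2_gates_def split: if_splits)
  obtain CA where CA: "map fst CA = ?T" "\<forall>(i, g)\<in>set CA. g \<in> ?P i" "A = circuit_op N CA"
    using word_ops_circuit[OF chain_gates_carrier tri(1)] by blast
  obtain CB where CB: "map fst CB = ?T" "\<forall>(i, g)\<in>set CB. g \<in> ?Q i" "B = circuit_op N CB"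
    using word_ops_circuit[OF chain_gates_carrier tri(2)] by blast
  obtain C where C: "map fst C = ?T" "\<forall>(i, g)\<in>set C. g \<in> ?R i" "U = circuit_op N C"
    using word_ops_circuit[OF rot2_gates_carrier[OF neq] R_tri] by blast
  obtain D where D: "map fst D = ?S" "\<forall>(i, g)\<in>set D. g \<in> ?R i" "U = circuit_op N D"
    using word_ops_circuit[OF rot2_gates_carrier[OF neq] R_square] by blast
  have triangles: "is_triangle_circuit N CA" "is_triangle_circuit N CB" "is_triangle_circuit N C"
    using CA(1) CB(1) C(1) N by (simp_all add: is_triangle_circuit_iff)
  have square: "is_square_circuit N D"
    using D(1) by (rule is_square_circuit_brick)
  have "\<forall>(i, g)\<in>set CA. (odd i \<longrightarrow> (\<exists>\<theta>. g = rot N \<alpha> i \<theta>)) \<and> (even i \<longrightarrow> (\<exists>\<theta>. g = rot N \<beta> i \<theta>))"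
    "\<forall>(i, g)\<in>set CB. (odd i \<longrightarrow> (\<exists>\<theta>. g = rot N \<beta> i \<theta>)) \<and> (even i \<longrightarrow> (\<exists>\<theta>. g = rot N \<alpha> i \<theta>))"
    using CA(2) CB(2) by (fastforce simp: chain_gates_def split: if_splits)+
  moreover have "\<forall>(i, g)\<in>set C. \<exists>\<theta> \<theta>'. g = rot2 N \<alpha> \<beta> i \<theta> \<theta>'"
    "\<forall>(i, g)\<in>set D. \<exists>\<theta> \<theta>'. g = rot2 N \<alpha> \<beta> i \<theta> \<theta>'"
    using C(2) D(2) gate by fastforce+
  moreover have "is_circuit N D"
    unfolding is_circuit_def using D(2) gate by fastforce
  moreover have "U = circuit_op N CA * circuit_op N CB"
    by (simp add: AB(1) CA(3) CB(3))
  ultimately show "(\<exists>A B. is_triangle_circuit N A \<and> is_triangle_circuit N B \<and>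
         (\<forall>(i, g)\<in>set A. (odd i \<longrightarrow> (\<exists>\<theta>. g = rot N \<alpha> i \<theta>)) \<and> (even i \<longrightarrow> (\<exists>\<theta>. g = rot N \<beta> i \<theta>))) \<and>
         (\<forall>(i, g)\<in>set B. (odd i \<longrightarrow> (\<exists>\<theta>. g = rot N \<beta> i \<theta>)) \<and> (even i \<longrightarrow> (\<exists>\<theta>. g = rot N \<alpha> i \<theta>))) \<and>
         U = circuit_op N A * circuit_op N B) \<and>
      (\<exists>C. is_triangle_circuit N C \<and>
         (\<forall>(i, g)\<in>set C. \<exists>\<theta> \<theta>'. g = rot2 N \<alpha> \<beta> i \<theta> \<theta>') \<and> U = circuit_op N C) \<and>
      (\<exists>C. is_square_circuit N C \<and>
         (\<forall>(i, g)\<in>set C. \<exists>\<theta> \<theta>'. g = rot2 N \<alpha> \<beta> i \<theta> \<theta>') \<and> U = circuit_op N C) \<and>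
      (\<exists>C. is_circuit N C \<and>
         (\<forall>(i, g)\<in>set C. \<exists>\<theta> \<theta>'. g = rot2 N \<alpha> \<beta> i \<theta> \<theta>') \<and> U = circuit_op N C \<and>
         depth C \<le> N)"
    using triangles square depth_square_circuit[OF square] C(3) D(3) by blast
qed

end
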